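(* There exists an absolute constant $C$ such that for every $k, d, n \in \mathbb{N}$ with $k \leq d$, every $\alpha \in (0,1]$, and every $\varepsilon > 0$, there is an $\varepsilon$-differentially private sanitizer $\mathcal{A}$ (together with an evaluator $\mathcal{E}$) such that: on input a database $D \in (\{0,1\}^d)^n$, the total running time (of $\mathcal{A}$ and of $\mathcal{E}$) is at most $|D| \cdot d^{C\sqrt{k} \log(1/\alpha)}$, and, provided that $|D| \geq d^{C\sqrt{k} \log(1/\alpha)}/\varepsilon$, with probability at least $9/10$ over the coins of $\mathcal{A}$ the released summary $Z = \mathcal{A}(D)$ satisfies $|\mathcal{E}(Z,q) - q(D)| \leq \alpha$ simultaneously for every $k$-way marginal query $q$.
   Context: A database $D \in (\{0,1\}^d)^n$ is a list of $n$ rows $x^{(1)},\dots,x^{(n)} \in \{0,1\}^d$; two databases are adjacent if they differ in exactly one row. A sanitizer is a randomized algorithm $\mathcal{A}$ mapping databases to outputs in some set $\mathcal{R}$; it is $\varepsilon$-differentially private if for every pair of adjacent databases $D, D'$ and every measurable $S \subseteq \mathcal{R}$, $\Pr[\mathcal{A}(D) \in S] \leq e^{\varepsilon}\Pr[\mathcal{A}(D') \in S]$. Answers to queries are computed from the output by a deterministic evaluator $\mathcal{E}: \mathcal{R} \times \mathcal{Q} \to \mathbb{R}$. A $k$-way marginal query is specified by a set $S \subseteq [d]$ with $|S| \leq k$ and a pattern $t \in \{0,1\}^{S}$; its value on $D$ is $q(D) = \frac{1}{n}|\{i : x^{(i)}_j = t_j \text{ for all } j \in S\}|$.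
   Formalization: The formal theorem assumes d ≥ 2: at d = 1 the bound d^{C√k log(1/α)} is 1 for every C and the claim fails (d = k = n = 1, ε = 1, α = 1/4: accuracy on both adjacent databases contradicts ε-differential privacy); d = 0 is degenerate. *)

theory Defs
  imports "HOL-Probability.Probability"
begin

subsection \<open>Databases, marginal queries, privacy\<close>

type_synonym database = "bool list list"

definition databases :: "nat \<Rightarrow> nat \<Rightarrow> database set" where
  "databases n d = {D. length D = n \<and> (\<forall>x\<in>set D. length x = d)}"

definition adjacent :: "database \<Rightarrow> database \<Rightarrow> bool" where
  "adjacent D D' \<longleftrightarrow> length D = length D' \<and> card {i. i < length D \<and> D ! i \<noteq> D' ! i} = 1"

text \<open>A query \<open>(S, t)\<close> with \<open>t \<in> {0,1}\<^sup>S\<close> is the partial map \<open>t\<close> with domain \<open>S\<close>;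
  attributes are numbered from \<open>0\<close>.\<close>

type_synonym marginal_query = "nat \<rightharpoonup> bool"

definition marginals :: "nat \<Rightarrow> nat \<Rightarrow> marginal_query set" where
  "marginals d k = {q. dom q \<subseteq> {..<d} \<and> card (dom q) \<le> k}"

definition query_value :: "marginal_query \<Rightarrow> database \<Rightarrow> real" where
  "query_value q D =
     real (card {i. i < length D \<and> (\<forall>j\<in>dom q. D ! i ! j = the (q j))}) / real (length D)"

text \<open>The sanitizers below have the countable output set \<^typ>\<open>int list\<close>, on which every
  set is measurable.\<close>

definition differentially_private ::
    "real \<Rightarrow> nat \<Rightarrow> nat \<Rightarrow> (database \<Rightarrow> 'r pmf) \<Rightarrow> bool" where
  "differentially_private \<epsilon> n d A \<longleftrightarrow>
     (\<forall>D\<in>databases n d. \<forall>D'\<in>databases n d. adjacent D D' \<longrightarrow>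
        (\<forall>S. measure_pmf.prob (A D) S \<le> exp \<epsilon> * measure_pmf.prob (A D') S))"

subsection \<open>Machine model\<close>

text \<open>
  A random access machine with fair coins: memory cells holding integers (initially \<open>0\<close>),
  a read-only input array, a write-only output tape, and indirect addressing. Every instruction
  costs one step, and halting is free. There is deliberately no multiplication, division or
  shift instruction: with unit-cost multiplication, \<open>O(t)\<close> steps could build and exploit
  integers of \<open>2\<^sup>t\<close> bits, so that a bound on the number of steps would say little.
\<close>

datatype instr =
    Const nat int
  | Add nat nat nat
  | Sub nat nat nat
  | Load nat nat
  | Store nat nat
  | Read nat nat
  | Write nat
  | JumpPos nat nat
  | Coin nat

type_synonym program = "instr list"

record config =
  pc :: nat
  mem :: "nat \<Rightarrow> int"
  out :: "int list"

definition init :: config where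
  "init = \<lparr>pc = 0, mem = (\<lambda>_. 0), out = []\<rparr>"

definition halted :: "program \<Rightarrow> config \<Rightarrow> bool" where
  "halted P c \<longleftrightarrow> length P \<le> pc c"

definition assign :: "nat \<Rightarrow> int \<Rightarrow> config \<Rightarrow> config" where
  "assign r v c = c\<lparr>pc := Suc (pc c), mem := (mem c)(r := v)\<rparr>"

definition input_cell :: "int list \<Rightarrow> int \<Rightarrow> int" where
  "input_cell xs a = (if 0 \<le> a \<and> a < int (length xs) then xs ! nat a else 0)"

text \<open>Load and Store address indirectly the cell \<open>nat (mem c a)\<close>, so a negative address
  denotes cell \<open>0\<close>.\<close>

fun exec_instr :: "int list \<Rightarrow> instr \<Rightarrow> config \<Rightarrow> config pmf" where
  "exec_instr xs (Const r v) c = return_pmf (assign r v c)"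
| "exec_instr xs (Add r a b) c = return_pmf (assign r (mem c a + mem c b) c)"
| "exec_instr xs (Sub r a b) c = return_pmf (assign r (mem c a - mem c b) c)"
| "exec_instr xs (Load r a) c = return_pmf (assign r (mem c (nat (mem c a))) c)"
| "exec_instr xs (Store a r) c = return_pmf (assign (nat (mem c a)) (mem c r) c)"
| "exec_instr xs (Read r a) c = return_pmf (assign r (input_cell xs (mem c a)) c)"
| "exec_instr xs (Write r) c = return_pmf (c\<lparr>pc := Suc (pc c), out := out c @ [mem c r]\<rparr>)"
| "exec_instr xs (JumpPos r l) c =
     return_pmf (c\<lparr>pc := (if mem c r > 0 then l else Suc (pc c))\<rparr>)"
| "exec_instr xs (Coin r) c =
     map_pmf (\<lambda>b. assign r (of_bool b) c) (bernoulli_pmf (1/2))"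

definition step :: "program \<Rightarrow> int list \<Rightarrow> config \<Rightarrow> config pmf" where
  "step P xs c = (if halted P c then return_pmf c else exec_instr xs (P ! pc c) c)"

primrec steps :: "program \<Rightarrow> int list \<Rightarrow> nat \<Rightarrow> config pmf" where
  "steps P xs 0 = return_pmf init"
| "steps P xs (Suc t) = bind_pmf (steps P xs t) (step P xs)"

text \<open>
  Worst-case running time over all coin outcomes. Since a program may be chosen separately for
  each choice of the parameters, it is also charged for its length, as is usual for nonuniform
  time; otherwise a program of exponential length could hard-wire a decision tree over all
  databases and merely pay for the depth of the tree.
\<close>

definition runs_within :: "program \<Rightarrow> int list \<Rightarrow> nat \<Rightarrow> bool" where
  "runs_within P xs t \<longleftrightarrow> length P \<le> t \<and> (\<forall>c\<in>set_pmf (steps P xs t). halted P c)"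

definition coin_free :: "program \<Rightarrow> bool" where
  "coin_free P \<longleftrightarrow> (\<forall>r. Coin r \<notin> set P)"

subsection \<open>Sanitizers and evaluators as algorithms\<close>

definition encode_database :: "database \<Rightarrow> int list" where
  "encode_database D = map of_bool (concat D)"

text \<open>One symbol per attribute, \<open>-1\<close> marking the attributes outside the domain.\<close>

definition encode_query :: "nat \<Rightarrow> marginal_query \<Rightarrow> int list" where
  "encode_query d q = map (\<lambda>j. case q j of None \<Rightarrow> - 1 | Some b \<Rightarrow> of_bool b) [0..<d]"

text \<open>The released summary is the content of the output tape.\<close>

definition sanitizer_in_time ::
    "nat \<Rightarrow> nat \<Rightarrow> nat \<Rightarrow> (database \<Rightarrow> int list pmf) \<Rightarrow> bool" where
  "sanitizer_in_time n d t A \<longleftrightarrow>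
     (\<exists>P. \<forall>D\<in>databases n d.
        runs_within P (encode_database D) t \<and>
        A D = map_pmf out (steps P (encode_database D) t))"

text \<open>The evaluator receives the query followed by the summary, and runs once per query. Its
  answer is a fixed-point number: the final content of cell \<open>0\<close> divided by a denominator \<open>s\<close>
  that belongs to the description of the evaluator and does not depend on its input.\<close>

definition evaluator_in_time ::
    "nat \<Rightarrow> nat \<Rightarrow> nat \<Rightarrow> (int list \<Rightarrow> marginal_query \<Rightarrow> real) \<Rightarrow> bool" where
  "evaluator_in_time d k t E \<longleftrightarrow>
     (\<exists>P s. coin_free P \<and> 0 < s \<and>
       (\<forall>z. \<forall>q\<in>marginals d k.
          runs_within P (encode_query d q @ z) t \<and>
          map_pmf (\<lambda>c. real_of_int (mem c 0) / real s) (steps P (encode_query d q @ z) t) =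
            return_pmf (E z q)))"

end

theory Submission
  imports Defs
begin

text \<open>
  A row satisfies a query iff the number \<open>v\<close> of literals of the query that it violates is 0.
  A rescaled Chebyshev polynomial of degree \<open>t = O(\<surd>k log (1/\<alpha>))\<close> in \<open>v\<close> is large at 0 and
  bounded on \<open>1, \<dots>, k\<close>, so, normalised at 0, it approximates the query within \<open>\<alpha>/2\<close>.
  Since \<open>v\<^sup>r\<close> counts the \<open>r\<close>-tuples of violated literals of the query, every marginal is
  approximately a fixed linear combination, with coefficients \<open>d\<^sup>O\<^sup>(\<^sup>t\<^sup>)\<close>, of the numbers of rows
  that violate all literals of a tuple of length at most \<open>t\<close>. The sanitizer releases these
  \<open>d\<^sup>O\<^sup>(\<^sup>t\<^sup>)\<close> counts with noise; accuracy is only claimed for \<open>n \<ge> d\<^sup>O\<^sup>(\<^sup>t\<^sup>) / \<epsilon>\<close>, where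
  the noise can be made negligible relative to the coefficients. Both programs are fully
  unrolled straight-line code, in which table lookups replace conditionals.
\<close>

subsection \<open>Straight-line programs\<close>

text \<open>Privacy must be exact and pure, but the machine has only fair coins and a worst-case
  time bound, while geometric noise has unbounded support. Hence the noise is random rounding to
  multiples of \<open>2^w\<close>, where neighbouring counts give output probabilities differing by
  at most \<open>2^-w\<close>, plus a rare uniform replacement that puts a floor
  \<open>2^-(g+h)\<close> under every grid point; relative to the floor the additive change is
  small. With \<open>N\<close> counts and coefficients up to \<open>M\<close>, accuracy wants
  \<open>N M 2^w\<close> of order \<alpha> \<open>n\<close>, reliability \<open>2^h\<close> of order
  \<open>N\<close>, and privacy \<open>N 2^(g+h)\<close> at most \<epsilon> \<open>2^w\<close>.
  These are compatible once \<open>n\<close> exceeds a fixed power of \<open>d^t\<close> over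
  \<epsilon>. The degree comes from growth just outside the interval: \<open>v = 0\<close> sits at
  \<open>1 + 1/k\<close>, where degree about \<open>sqrt k\<close> already gives the value 2, and
  multiplying the degree by \<open>j\<close> turns 2 into \<open>2^j\<close>. Without multiplication
  or division, coefficients act as repeated additions and the normalisation moves into the fixed
  denominator of the evaluator; this is why all coefficients are kept integral.\<close>

fun jump_free :: "instr \<Rightarrow> bool" where
  "jump_free (JumpPos r l) = False"
| "jump_free _ = True"

type_synonym store = "(nat \<Rightarrow> int) \<times> int list"

fun eff :: "int list \<Rightarrow> instr \<Rightarrow> store \<Rightarrow> store pmf" where
  "eff xs (Const r v) (m, w) = return_pmf (m(r := v), w)"
| "eff xs (Add r a b) (m, w) = return_pmf (m(r := m a + m b), w)"
| "eff xs (Sub r a b) (m, w) = return_pmf (m(r := m a - m b), w)"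
| "eff xs (Load r a) (m, w) = return_pmf (m(r := m (nat (m a))), w)"
| "eff xs (Store a r) (m, w) = return_pmf (m(nat (m a) := m r), w)"
| "eff xs (Read r a) (m, w) = return_pmf (m(r := input_cell xs (m a)), w)"
| "eff xs (Write r) (m, w) = return_pmf (m, w @ [m r])"
| "eff xs (JumpPos r l) (m, w) = return_pmf (m, w)"
| "eff xs (Coin r) (m, w) = map_pmf (\<lambda>b. (m(r := of_bool b), w)) (bernoulli_pmf (1/2))"

primrec run :: "int list \<Rightarrow> program \<Rightarrow> store \<Rightarrow> store pmf" where
  "run xs [] s = return_pmf s"
| "run xs (i # P) s = bind_pmf (eff xs i s) (run xs P)"

lemma run_append: "run xs (P @ Q) s = bind_pmf (run xs P s) (run xs Q)"
proof (induction P arbitrary: s)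
  case (Cons i P)
  then have "run xs (P @ Q) = (\<lambda>s. bind_pmf (run xs P s) (run xs Q))" by auto
  then show ?case by (simp add: bind_assoc_pmf)
qed (simp add: bind_return_pmf)

definition config_of :: "nat \<Rightarrow> store \<Rightarrow> config" where
  "config_of p s = \<lparr>pc = p, mem = fst s, out = snd s\<rparr>"

lemma config_of_sel [simp]:
  "pc (config_of p s) = p" "mem (config_of p s) = fst s" "out (config_of p s) = snd s"
  by (simp_all add: config_of_def)

lemma exec_instr_eff:
  assumes "jump_free i"
  shows "exec_instr xs i (config_of p s) = map_pmf (config_of (Suc p)) (eff xs i s)"
  using assms by (cases s; cases i) (auto simp: config_of_def assign_def map_pmf_comp)

text \<open>Without jumps the program counter after \<open>j\<close> steps is \<open>j\<close> on
  every coin outcome, so only the store is random. Time thus corresponds to prefixes of the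
  program.\<close>

lemma steps_run:
  assumes "list_all jump_free P" "j \<le> length P"
  shows "steps P xs j = map_pmf (config_of j) (run xs (take j P) (\<lambda>_. 0, []))"
  using assms(2)
proof (induction j)
  case 0
  then show ?case by (simp add: config_of_def init_def)
next
  case (Suc j)
  have jf: "jump_free (P ! j)" using assms(1) Suc.prems by (simp add: list_all_length)
  have tk: "take (Suc j) P = take j P @ [P ! j]" using Suc.prems by (simp add: take_Suc_conv_app_nth)
  have st: "step P xs (config_of j s) = map_pmf (config_of (Suc j)) (eff xs (P ! j) s)" for s
    using Suc.prems jf by (simp add: step_def halted_def exec_instr_eff)
  have "run xs [] = return_pmf" by auto
  then have r1: "run xs [P ! j] s = eff xs (P ! j) s" for s by (simp add: bind_return_pmf')
  have "steps P xs (Suc j) = bind_pmf (run xs (take j P) (\<lambda>_. 0, [])) (\<lambda>s. step P xs (config_of j s))"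
    using Suc by (simp add: bind_map_pmf)
  then show ?case unfolding st tk run_append r1 by (simp add: map_bind_pmf)
qed

lemma steps_straight_line:
  assumes "list_all jump_free P"
  shows "steps P xs (length P) = map_pmf (config_of (length P)) (run xs P (\<lambda>_. 0, []))"
  using steps_run[OF assms, of "length P"] by simp

text \<open>The program length settles both charges of \<open>runs_within\<close> at once, and for
  every input; time bounds below are therefore bounds on code length.\<close>

lemma runs_within_straight_line:
  assumes "list_all jump_free P"
  shows "runs_within P xs (length P)"
  using assms by (auto simp: runs_within_def steps_straight_line halted_def)

lemma sanitizer_straight_line:
  assumes "list_all jump_free P"
    and "\<And>D. D \<in> databases n d \<Longrightarrow> A D = map_pmf snd (run (encode_database D) P (\<lambda>_. 0, []))"
  shows "sanitizer_in_time n d (length P) A"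
  unfolding sanitizer_in_time_def using assms
  by (intro exI[of _ P])
     (auto simp: runs_within_straight_line steps_straight_line map_pmf_comp)

lemma evaluator_straight_line:
  assumes "list_all jump_free P" "coin_free P" "0 < s"
    and "\<And>z q. q \<in> marginals d k \<Longrightarrow>
           \<exists>m w. run (encode_query d q @ z) P (\<lambda>_. 0, []) = return_pmf (m, w) \<and> E z q = real_of_int (m 0) / real s"
  shows "evaluator_in_time d k (length P) E"
  unfolding evaluator_in_time_def
proof (intro exI[of _ P] exI[of _ s] conjI allI ballI)
  fix z q assume "q \<in> marginals d k"
  from assms(4)[OF this, of z] obtain m w where
    "run (encode_query d q @ z) P (\<lambda>_. 0, []) = return_pmf (m, w)" "E z q = real_of_int (m 0) / real s"
    by blast
  then show "map_pmf (\<lambda>c. real_of_int (mem c 0) / real s)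
      (steps P (encode_query d q @ z) (length P)) = return_pmf (E z q)"
    by (simp add: steps_straight_line[OF assms(1)] map_pmf_comp)
qed (use assms runs_within_straight_line in auto)

section \<open>Building blocks: tables, conjunctions and uniform integers\<close>

lemma run_Const_table:
  "run xs (map (\<lambda>i. Const i (f i)) [0..<N]) (m, w) =
     return_pmf (\<lambda>i. if i < N then f i else m i, w)"
proof (induction N)
  case (Suc N)
  have "(\<lambda>i. if i < N then f i else m i)(N := f N) = (\<lambda>i. if i < Suc N then f i else m i)"
    by (auto simp: less_Suc_eq)
  then show ?case by (simp add: run_append Suc bind_return_pmf)
qed simp

text \<open>Cells 0, 1, 2 hold 0, 0, 1, so that loading from the address \<open>a + b\<close> computes the
  conjunction of two bits without a jump.\<close>

definition conj_code :: "('l \<Rightarrow> program) \<Rightarrow> 'l list \<Rightarrow> program" where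
  "conj_code lc \<tau> = Const 3 1 # concat (map (\<lambda>l. lc l @ [Add 3 3 4, Const 4 0, Load 3 3]) \<tau>)"

lemma run_conj_code:
  assumes lc: "\<And>l b. l \<in> set \<tau> \<Longrightarrow>
      run xs (lc l) (m(3 := of_bool b), w) = return_pmf (m(3 := of_bool b, 4 := of_bool (\<phi> l)), w)"
    and m: "m 0 = 0" "m 1 = 0" "m 2 = 1" "m 4 = 0"
  shows "run xs (conj_code lc \<tau>) (m, w) = return_pmf (m(3 := of_bool (list_all \<phi> \<tau>)), w)"
proof -
  \<comment> \<open>Generalised to an arbitrary bit \<open>b\<close> in cell 3, the conjunction of
    the literals already treated.\<close>
  have *: "run xs (concat (map (\<lambda>l. lc l @ [Add 3 3 4, Const 4 0, Load 3 3]) \<tau>)) (m(3 := of_bool b), w)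
      = return_pmf (m(3 := of_bool (b \<and> list_all \<phi> \<tau>)), w)" for b
    using lc
  proof (induction \<tau> arbitrary: b)
    case (Cons l \<tau>)
    have three: "run xs [Add 3 3 4, Const 4 0, Load 3 3] (m(3 := of_bool b, 4 := of_bool p), w) =
        return_pmf (m(3 := of_bool (b \<and> p)), w)" for p
      using m by (cases b; cases p) (auto simp: bind_return_pmf fun_eq_iff numeral_2_eq_2)
    have IH: "run xs (concat (map (\<lambda>l. lc l @ [Add 3 3 4, Const 4 0, Load 3 3]) \<tau>))
        (m(3 := of_bool b'), w) = return_pmf (m(3 := of_bool (b' \<and> list_all \<phi> \<tau>)), w)" for b'
      by (rule Cons.IH) (use Cons.prems in auto)
    have "run xs (concat (map (\<lambda>l. lc l @ [Add 3 3 4, Const 4 0, Load 3 3]) (l # \<tau>))) (m(3 := of_bool b), w) =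
       run xs (concat (map (\<lambda>l. lc l @ [Add 3 3 4, Const 4 0, Load 3 3]) \<tau>)) (m(3 := of_bool (b \<and> \<phi> l)), w)"
      using three[of "\<phi> l"] by (simp only: list.map concat.simps append_assoc run_append
          Cons.prems[OF list.set_intros(1)] bind_return_pmf)
    then show ?case by (simp only: IH list.pred_inject conj_assoc)
  qed simp
  show ?thesis using *[of True] by (simp add: conj_code_def bind_return_pmf)
qed

text \<open>Horner's scheme in base 2, most significant bit first; doubling is an addition of cell 6
  to itself.\<close>

primrec unif_code :: "nat \<Rightarrow> program" where
  "unif_code 0 = []"
| "unif_code (Suc w) = unif_code w @ [Add 6 6 6, Coin 4, Add 6 6 4, Const 4 0]"

primrec unif :: "nat \<Rightarrow> nat pmf" where
  "unif 0 = return_pmf 0"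
| "unif (Suc w) = bind_pmf (unif w) (\<lambda>v. map_pmf (\<lambda>b. 2 * v + of_bool b) (bernoulli_pmf (1/2)))"

lemma run_unif_code:
  assumes "m 4 = 0" "m 6 = 0"
  shows "run xs (unif_code w) (m, z) = map_pmf (\<lambda>v. (m(6 := int v), z)) (unif w)"
proof (induction w)
  case 0
  have "m(6 := 0) = m" using assms by (simp add: fun_upd_idem)
  then show ?case by (simp del: fun_upd_apply)
next
  case (Suc w)
  have four: "run xs [Add 6 6 6, Coin 4, Add 6 6 4, Const 4 0] (m(6 := int v), z) =
      map_pmf (\<lambda>b. (m(6 := int (2 * v + of_bool b)), z)) (bernoulli_pmf (1/2))" for v
    using assms by (simp add: bind_map_pmf bind_return_pmf map_pmf_def bind_assoc_pmf)
      (intro bind_pmf_cong refl arg_cong[of _ _ return_pmf], auto simp: fun_eq_iff)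
  show ?case
    by (simp only: unif_code.simps unif.simps run_append Suc bind_map_pmf four map_bind_pmf map_pmf_comp)
qed

text \<open>The last coin is the parity of \<open>x\<close> and the earlier ones form
  \<open>x div 2\<close>, so each \<open>x\<close> arises in exactly one way and its probability is
  halved in each round.\<close>

lemma unif_eq: "unif w = pmf_of_set {..<2 ^ w}"
proof (induction w)
  case 0
  then show ?case by (simp add: pmf_of_set_singleton lessThan_Suc)
next
  case (Suc w)
  show ?case
  proof (rule pmf_eqI)
    fix x :: nat
    have "pmf (unif (Suc w)) x = (\<Sum>v<2^w. pmf (map_pmf (\<lambda>b. 2 * v + of_bool b) (bernoulli_pmf (1/2))) x / 2 ^ w)"
      by (simp add: Suc pmf_bind integral_pmf_of_set sum_divide_distrib lessThan_empty_iff)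
    also have "\<dots> = (\<Sum>v<2^w. (if v = x div 2 then 1 / 2 / 2 ^ w else 0))"
    proof (rule sum.cong)
      fix v :: nat
      have "pmf (map_pmf (\<lambda>b. 2 * v + of_bool b) (bernoulli_pmf (1/2))) x =
          (if v = x div 2 then 1 / 2 else 0)"
      proof (cases "v = x div 2")
        case True
        have "inj (\<lambda>b. 2 * v + (of_bool b :: nat))" by (auto simp: inj_def split: if_splits)
        moreover have "x = 2 * v + of_bool (odd x)" using True by (auto simp: odd_two_times_div_two_nat)
        ultimately show ?thesis using True pmf_map_inj'[of "\<lambda>b. 2 * v + (of_bool b :: nat)" "bernoulli_pmf (1/2)" "odd x"]
          by (cases "odd x") auto
      next
        case False
        then have "x \<notin> set_pmf (map_pmf (\<lambda>b. 2 * v + of_bool b) (bernoulli_pmf (1/2)))"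
          by auto
        then show ?thesis using False by (simp add: set_pmf_eq)
      qed
      then show "pmf (map_pmf (\<lambda>b. 2 * v + of_bool b) (bernoulli_pmf (1/2))) x / 2 ^ w = (if v = x div 2 then 1 / 2 / 2 ^ w else 0)"
        by simp
    qed simp
    also have "\<dots> = pmf (pmf_of_set {..<2 ^ Suc w}) x"
      using pmf_of_set[of "{..<2 ^ Suc w}" x]
      by (auto simp: sum.delta indicator_def lessThan_empty_iff)
    finally show "pmf (unif (Suc w)) x = pmf (pmf_of_set {..<2 ^ Suc w}) x" .
  qed
qed

subsection \<open>Chebyshev polynomials\<close>

text \<open>The Chebyshev polynomial \<open>T\<^sub>m\<close> at \<open>(k + 1 - v) / k\<close>, scaled by \<open>k\<^sup>m\<close> to have integer
  coefficients in \<open>v\<close>.\<close>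

fun cheb_coeff :: "nat \<Rightarrow> nat \<Rightarrow> nat \<Rightarrow> int" where
  "cheb_coeff k 0 r = (if r = 0 then 1 else 0)"
| "cheb_coeff k (Suc 0) r = (if r = 0 then int k + 1 else if r = 1 then - 1 else 0)"
| "cheb_coeff k (Suc (Suc m)) r =
     2 * (int k + 1) * cheb_coeff k (Suc m) r
     - 2 * (if r = 0 then 0 else cheb_coeff k (Suc m) (r - 1))
     - int k ^ 2 * cheb_coeff k m r"

text \<open>The recurrence \<open>T_(m+2) = 2 y T_(m+1) - T_m\<close> at
  \<open>y = (k + 1 - v) / k\<close>, multiplied by \<open>k^(m+2)\<close>.\<close>

fun cheb :: "nat \<Rightarrow> nat \<Rightarrow> nat \<Rightarrow> int" where
  "cheb k 0 v = 1"
| "cheb k (Suc 0) v = int k + 1 - int v"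
| "cheb k (Suc (Suc m)) v =
     2 * (int k + 1 - int v) * cheb k (Suc m) v - int k ^ 2 * cheb k m v"

text \<open>The upper limit \<open>t\<close> may exceed the degree, so that the polynomials of
  different degree in the recurrence can be summed over the same range.\<close>

lemma sum_cheb_coeff: "m \<le> t \<Longrightarrow> (\<Sum>r\<le>t. cheb_coeff k m r * int v ^ r) = cheb k m v"
proof (induction k m v arbitrary: t rule: cheb.induct)
  case (1 k v)
  have "(\<Sum>r\<le>t. cheb_coeff k 0 r * int v ^ r) = (\<Sum>r\<in>{0}. cheb_coeff k 0 r * int v ^ r)"
    by (intro sum.mono_neutral_right) auto
  then show ?case by simp
next
  case (2 k v)
  have "(\<Sum>r\<le>t. cheb_coeff k (Suc 0) r * int v ^ r) = (\<Sum>r\<in>{0, 1}. cheb_coeff k (Suc 0) r * int v ^ r)"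
    using 2 by (intro sum.mono_neutral_right) auto
  then show ?case by simp
next
  case (3 k m v)
  obtain t' where t: "t = Suc t'" "Suc m \<le> t'" using 3(3) by (cases t) auto
  \<comment> \<open>Multiplication by \<open>v\<close> shifts the coefficients by one, which turns
    the limit \<open>t\<close> into \<open>t'\<close>.\<close>
  have shift: "(\<Sum>r\<le>t. (if r = 0 then 0 else cheb_coeff k (Suc m) (r - 1)) * int v ^ r) =
      int v * cheb k (Suc m) v"
    using 3(1)[of t'] t(2)
    by (simp add: t(1) sum.atMost_Suc_shift mult_ac del: sum.atMost_Suc)
      (simp add: sum_distrib_left[symmetric])
  have "(\<Sum>r\<le>t. cheb_coeff k (Suc (Suc m)) r * int v ^ r) =
      2 * (int k + 1) * (\<Sum>r\<le>t. cheb_coeff k (Suc m) r * int v ^ r)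
      - 2 * (\<Sum>r\<le>t. (if r = 0 then 0 else cheb_coeff k (Suc m) (r - 1)) * int v ^ r)
      - int k ^ 2 * (\<Sum>r\<le>t. cheb_coeff k m r * int v ^ r)"
    unfolding sum_distrib_left sum_subtractf[symmetric]
    by (intro sum.cong) (auto simp: algebra_simps)
  then show ?case using 3 shift by (simp add: algebra_simps)
qed

text \<open>With base \<open>c k\<close> the recurrence requires
  \<open>(2 c + 1) k^2 + 4 c k \<le> c^2 k^2\<close>, for which \<open>6 c + 1 \<le> c^2\<close>
  suffices when \<open>k \<ge> 1\<close>; 7 is the least such positive integer.\<close>

lemma abs_cheb_coeff_le:
  assumes "1 \<le> k"
  shows "\<bar>cheb_coeff k m r\<bar> \<le> (7 * int k) ^ m"
  using assms
proof (induction k m r rule: cheb_coeff.induct)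
  case (3 k m r)
  let ?A = "cheb_coeff k (Suc m) r" and ?B = "if r = 0 then 0 else cheb_coeff k (Suc m) (r - 1)"
  let ?P = "(7 * int k) ^ m"
  have k: "1 \<le> int k" using 3 by simp
  have A: "\<bar>?A\<bar> \<le> 7 * int k * ?P" and B: "\<bar>?B\<bar> \<le> 7 * int k * ?P"
    and C: "\<bar>cheb_coeff k m r\<bar> \<le> ?P"
    using 3 by (auto split: if_splits)
  have "\<bar>cheb_coeff k (Suc (Suc m)) r\<bar> \<le>
      2 * (int k + 1) * \<bar>?A\<bar> + 2 * \<bar>?B\<bar> + int k ^ 2 * \<bar>cheb_coeff k m r\<bar>"
  proof -
    have e: "\<bar>2 * (int k + 1) * ?A\<bar> = 2 * (int k + 1) * \<bar>?A\<bar>" "\<bar>2 * ?B\<bar> = 2 * \<bar>?B\<bar>"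
      "\<bar>int k ^ 2 * cheb_coeff k m r\<bar> = int k ^ 2 * \<bar>cheb_coeff k m r\<bar>"
      by (simp_all add: abs_mult)
    show ?thesis unfolding cheb_coeff.simps(3) e[symmetric] by linarith
  qed
  also have "\<dots> \<le> 2 * (int k + 1) * (7 * int k * ?P) + 2 * (7 * int k * ?P) + int k ^ 2 * ?P"
    using A B C by (intro add_mono mult_left_mono) auto
  also have "\<dots> = (15 * int k ^ 2 + 28 * int k) * ?P"
    by (simp add: algebra_simps power2_eq_square)
  also have "\<dots> \<le> (49 * int k ^ 2) * ?P"
  proof (intro mult_right_mono)
    have "int k * 1 \<le> int k * int k" using k by (intro mult_left_mono) auto
    then show "15 * (int k)\<^sup>2 + 28 * int k \<le> 49 * (int k)\<^sup>2" using k by (simp add: power2_eq_square)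
  qed auto
  also have "\<dots> = (7 * int k) ^ Suc (Suc m)" by (simp add: power2_eq_square)
  finally show ?case .
qed auto

text \<open>For these \<open>v\<close> the argument lies in the interval from -1 to 1, hence is some
  \<open>cos \<theta>\<close>, and \<open>T_m (cos \<theta>) = cos (m \<theta>)\<close>.\<close>

lemma abs_cheb_le:
  assumes "1 \<le> v" "v \<le> k"
  shows "\<bar>cheb k m v\<bar> \<le> int k ^ m"
proof -
  define y where "y = (real k + 1 - real v) / real k"
  have k: "0 < real k" using assms by simp
  have "- 1 \<le> y" "y \<le> 1" using assms k by (auto simp: y_def field_simps)
  then obtain \<theta> where y: "y = cos \<theta>" by (metis cos_arccos)
  have yk: "real k + 1 - real v = real k * cos \<theta>" using k by (simp add: y_def flip: y)
  have "real_of_int (cheb k m v) = real k ^ m * cos (real m * \<theta>)"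
    using yk
  proof (induction k m v rule: cheb.induct)
    case (3 k m v)
    have c: "cos (real (Suc (Suc m)) * \<theta>) = 2 * cos \<theta> * cos (real (Suc m) * \<theta>) - cos (real m * \<theta>)"
    proof -
      have "cos (real (Suc m) * \<theta> + \<theta>) + cos (real (Suc m) * \<theta> - \<theta>) = 2 * cos \<theta> * cos (real (Suc m) * \<theta>)"
        by (simp add: cos_add cos_diff)
      then show ?thesis by (simp add: algebra_simps)
    qed
    have "real_of_int (cheb k (Suc (Suc m)) v) =
        2 * (real k * cos \<theta>) * (real k ^ Suc m * cos (real (Suc m) * \<theta>)) - real k ^ 2 * (real k ^ m * cos (real m * \<theta>))"
      using 3 by (simp only: cheb.simps(3)) simp
    also have "\<dots> = real k ^ Suc (Suc m) * cos (real (Suc (Suc m)) * \<theta>)"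
      unfolding c by (simp add: algebra_simps power2_eq_square)
    finally show ?case .
  qed auto
  then have "\<bar>real_of_int (cheb k m v)\<bar> \<le> real k ^ m * 1"
    by (simp only: abs_mult) (intro mult_mono; simp)
  then have "real_of_int \<bar>cheb k m v\<bar> \<le> real_of_int (int k ^ m)" by simp
  then show ?thesis by linarith
qed

section \<open>Growth of Chebyshev polynomials to the right of 1\<close>

lemma cosh_Suc_Suc_mult:
  fixes \<theta> :: real
  shows "cosh (real (Suc (Suc m)) * \<theta>) = 2 * cosh \<theta> * cosh (real (Suc m) * \<theta>) - cosh (real m * \<theta>)"
proof -
  have "cosh (real (Suc m) * \<theta> + \<theta>) + cosh (real (Suc m) * \<theta> - \<theta>) = 2 * cosh \<theta> * cosh (real (Suc m) * \<theta>)"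
    by (simp add: cosh_add cosh_diff)
  then show ?thesis by (simp add: algebra_simps)
qed

text \<open>Quadratic growth in the degree, the source of the square root in the exponent: at
  distance \<open>1/k\<close> beyond 1, degree \<open>sqrt k\<close> suffices for a constant
  gain.\<close>

lemma cosh_mult_ge:
  fixes \<theta> :: real
  shows "1 + (real r)\<^sup>2 * (cosh \<theta> - 1) \<le> cosh (real r * \<theta>)"
proof -
  \<comment> \<open>The induction also carries the increments: by the recurrence each exceeds the
    previous one by \<open>2 (cosh \<theta> - 1) cosh ((r + 1) \<theta>)\<close>, which is at least
    \<open>2 (cosh \<theta> - 1)\<close>.\<close>
  have "1 + (real r)\<^sup>2 * (cosh \<theta> - 1) \<le> cosh (real r * \<theta>) \<and>
      (2 * real r + 1) * (cosh \<theta> - 1) \<le> cosh (real (Suc r) * \<theta>) - cosh (real r * \<theta>)"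
  proof (induction r)
    case (Suc r)
    have d: "0 \<le> cosh \<theta> - 1" using cosh_real_ge_1[of \<theta>] by simp
    have "0 \<le> (cosh \<theta> - 1) * (cosh (real (Suc r) * \<theta>) - 1)"
      using d cosh_real_ge_1[of "real (Suc r) * \<theta>"] by (intro mult_nonneg_nonneg) auto
    then have "(2 * real r + 1) * (cosh \<theta> - 1) + 2 * (cosh \<theta> - 1) \<le>
        cosh (real (Suc r) * \<theta>) - cosh (real r * \<theta>) + 2 * (cosh \<theta> - 1) * cosh (real (Suc r) * \<theta>)"
      using Suc by (simp add: algebra_simps)
    then have 1: "(2 * real (Suc r) + 1) * (cosh \<theta> - 1) \<le> cosh (real (Suc (Suc r)) * \<theta>) - cosh (real (Suc r) * \<theta>)"
      unfolding cosh_Suc_Suc_mult by (simp add: algebra_simps)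
    have 2: "1 + (real (Suc r))\<^sup>2 * (cosh \<theta> - 1) \<le> cosh (real (Suc r) * \<theta>)"
      using Suc by (simp add: algebra_simps power2_eq_square)
    from 1 2 show ?case by blast
  qed simp
  then show ?thesis by blast
qed

lemma power_cosh_le:
  fixes \<theta> :: real
  assumes "0 \<le> \<theta>"
  shows "cosh \<theta> ^ j \<le> cosh (real j * \<theta>)"
proof (induction j)
  case (Suc j)
  have "cosh \<theta> * cosh \<theta> ^ j \<le> cosh \<theta> * cosh (real j * \<theta>)"
    using Suc cosh_real_ge_1[of \<theta>] by (intro mult_left_mono) auto
  also have "\<dots> \<le> cosh \<theta> * cosh (real j * \<theta>) + sinh \<theta> * sinh (real j * \<theta>)"
    using assms by simp
  also have "\<dots> = cosh (real (Suc j) * \<theta>)" by (simp add: algebra_simps flip: cosh_add)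
  finally show ?case by simp
qed simp

text \<open>At \<open>v = 0\<close> the argument is \<open>1 + 1/k = cosh \<theta>\<close>. Since
  \<open>r^2 \<ge> k\<close>, quadratic growth gives \<open>cosh (r \<theta>) \<ge> 2\<close>, and
  amplification by \<open>j\<close> gives \<open>2^j\<close>.\<close>

lemma cheb_0_ge:
  assumes "1 \<le> k" "k \<le> r ^ 2"
  shows "int k ^ (j * r) * 2 ^ j \<le> cheb k (j * r) 0"
proof -
  have k: "0 < real k" using assms by simp
  define \<theta> where "\<theta> = arcosh (1 + 1 / real k)"
  have \<theta>: "cosh \<theta> = 1 + 1 / real k" "0 \<le> \<theta>"
    using k by (auto simp: \<theta>_def cosh_arcosh_real arcosh_nonneg_real)
  have yk: "real k + 1 = real k * cosh \<theta>" using k by (simp add: \<theta> field_simps)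
  have cl: "real_of_int (cheb k m 0) = real k ^ m * cosh (real m * \<theta>)" for m
  proof (induction m rule: induct_nat_012)
    case (ge2 m)
    have "real_of_int (cheb k (Suc (Suc m)) 0) =
        2 * (real k + 1) * real_of_int (cheb k (Suc m) 0) - real k ^ 2 * real_of_int (cheb k m 0)"
      by simp
    also have "\<dots> = real k ^ Suc (Suc m) * cosh (real (Suc (Suc m)) * \<theta>)"
      unfolding cosh_Suc_Suc_mult ge2 yk by (simp add: algebra_simps power2_eq_square)
    finally show ?case .
  qed (use yk in auto)
  have "real k \<le> (real r)\<^sup>2" using assms(2) by (metis of_nat_le_iff of_nat_power)
  then have "2 \<le> 1 + (real r)\<^sup>2 * (cosh \<theta> - 1)" using k by (simp add: \<theta> field_simps)
  also have "\<dots> \<le> cosh (real r * \<theta>)" by (rule cosh_mult_ge)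
  finally have "2 ^ j \<le> cosh (real r * \<theta>) ^ j" by (intro power_mono) auto
  also have "\<dots> \<le> cosh (real j * (real r * \<theta>))" using \<theta> by (intro power_cosh_le) simp
  finally have "real k ^ (j * r) * 2 ^ j \<le> real k ^ (j * r) * cosh (real (j * r) * \<theta>)"
    by (intro mult_left_mono) (auto simp: mult_ac)
  then have "real_of_int (int k ^ (j * r) * 2 ^ j) \<le> real_of_int (cheb k (j * r) 0)"
    unfolding cl by simp
  then show ?thesis by linarith
qed

subsection \<open>Noise from fair coins\<close>

text \<open>Reduces privacy for all events to a comparison of single outputs.\<close>

lemma prob_le_of_pmf_le:
  assumes "\<And>x. pmf p x \<le> c * pmf q x" "0 \<le> c"
  shows "measure_pmf.prob p S \<le> c * measure_pmf.prob q S"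
proof -
  have "emeasure (measure_pmf p) S = (\<integral>\<^sup>+ x. indicator S x \<partial>measure_pmf p)" by simp
  also have "\<dots> = (\<integral>\<^sup>+ x. ennreal (pmf p x) * indicator S x \<partial>count_space UNIV)"
    by (rule nn_integral_measure_pmf)
  also have "\<dots> \<le> (\<integral>\<^sup>+ x. ennreal c * (ennreal (pmf q x) * indicator S x) \<partial>count_space UNIV)"
    using assms by (intro nn_integral_mono)
      (auto simp: indicator_def ennreal_mult[symmetric] intro!: ennreal_leI)
  also have "\<dots> = ennreal c * (\<integral>\<^sup>+ x. ennreal (pmf q x) * indicator S x \<partial>count_space UNIV)"
    by (intro nn_integral_cmult) auto
  also have "(\<integral>\<^sup>+ x. ennreal (pmf q x) * indicator S x \<partial>count_space UNIV) =
      (\<integral>\<^sup>+ x. indicator S x \<partial>measure_pmf q)"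
    by (rule nn_integral_measure_pmf[symmetric])
  also have "\<dots> = emeasure (measure_pmf q) S" by simp
  finally show ?thesis
    using assms(2) by (simp add: measure_pmf.emeasure_eq_measure ennreal_mult[symmetric])
qed

text \<open>A count \<open>c\<close> is rounded at random to a multiple of \<open>2\<^sup>w\<close> and then, with probability
  \<open>2\<^sup>-\<^sup>h\<close>, replaced by a uniform element of the grid \<open>{..<2\<^sup>g}\<close>. Rounding makes each output
  probability \<open>2\<^sup>-\<^sup>w\<close>-Lipschitz in \<open>c\<close>, and the replacement bounds it from below.\<close>

definition noisy_count :: "nat \<Rightarrow> nat \<Rightarrow> nat \<Rightarrow> nat \<Rightarrow> int pmf" where
  "noisy_count w g h c = bind_pmf (unif w) (\<lambda>u.
     map_pmf (\<lambda>v. if v < 2 ^ g then int v else int ((c + u) div 2 ^ w)) (unif (g + h)))"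

primrec noisy_counts :: "nat \<Rightarrow> nat \<Rightarrow> nat \<Rightarrow> nat list \<Rightarrow> int list pmf" where
  "noisy_counts w g h [] = return_pmf []"
| "noisy_counts w g h (c # cs) =
     bind_pmf (noisy_count w g h c) (\<lambda>y. map_pmf ((#) y) (noisy_counts w g h cs))"

text \<open>One draw of \<open>g + h\<close> bits serves twice: \<open>v < 2^g\<close> decides on
  the replacement, and given this event \<open>v\<close> is itself uniform on the grid.\<close>

lemma prob_unif_lessThan: "measure_pmf.prob (unif (g + h)) {v. v < 2 ^ g} = 1 / 2 ^ h"
proof -
  have "{..<2 ^ (g + h)} \<inter> {v. v < 2 ^ g} = {..<2 ^ g :: nat}"
    using power_increasing[of g "g + h" "2 :: nat"] by (auto intro: less_le_trans)
  then show ?thesis by (simp add: unif_eq measure_pmf_of_set lessThan_empty_iff power_add)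
qed

definition rounding_weight :: "nat \<Rightarrow> nat \<Rightarrow> int \<Rightarrow> real" where
  "rounding_weight w c y = real (card {u. u < 2 ^ w \<and> int ((c + u) div 2 ^ w) = y}) / 2 ^ w"

lemma pmf_noisy_count:
  "pmf (noisy_count w g h c) y =
     (if 0 \<le> y \<and> y < 2 ^ g then 1 / 2 ^ (g + h) else 0) + (1 - 1 / 2 ^ h) * rounding_weight w c y"
proof -
  let ?V = "\<lambda>u v. if v < 2 ^ g then int v else int ((c + u) div 2 ^ w)"
  have ne: "{..<2 ^ m} \<noteq> ({} :: nat set)" for m by (simp add: lessThan_empty_iff)
  have gh: "(2::nat) ^ g \<le> 2 ^ (g + h)" by (simp add: power_increasing)
  have gh': "(2::int) ^ g \<le> 2 ^ (g + h)" by (simp add: power_increasing)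
  have inner: "pmf (map_pmf (?V u) (unif (g + h))) y =
      (if 0 \<le> y \<and> y < 2 ^ g then 1 / 2 ^ (g + h) else 0) +
      (1 - 1 / 2 ^ h) * of_bool (int ((c + u) div 2 ^ w) = y)" for u
  proof -
    let ?B = "int ((c + u) div 2 ^ w) = y"
    have "pmf (map_pmf (?V u) (unif (g + h))) y = measure_pmf.prob (unif (g + h)) (?V u -` {y})"
      by (simp add: pmf_map)
    also have "\<dots> = real (card ({..<2 ^ (g + h)} \<inter> ?V u -` {y})) / 2 ^ (g + h)"
      by (simp add: unif_eq measure_pmf_of_set ne)
    \<comment> \<open>A draw below \<open>2^g\<close> yields \<open>y\<close> only if it equals
      \<open>y\<close>; the remaining draws all yield the rounded count, so they count all or not at
      all.\<close>
    also have "{..<2 ^ (g + h)} \<inter> ?V u -` {y} =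
        (if 0 \<le> y \<and> y < 2 ^ g then {nat y} else {}) \<union> (if ?B then {2 ^ g..<2 ^ (g + h)} else {})"
      using gh by (auto split: if_splits simp: nat_less_iff intro: less_le_trans[OF _ gh] less_le_trans[OF _ gh'])
    also have "real (card \<dots>) = (if 0 \<le> y \<and> y < 2 ^ g then 1 else 0) + (2 ^ (g + h) - 2 ^ g) * of_bool ?B"
      using gh by (subst card_Un_disjoint) (auto simp: nat_less_iff of_nat_diff)
    also have "((if 0 \<le> y \<and> y < 2 ^ g then 1 else 0) + (2 ^ (g + h) - 2 ^ g) * of_bool ?B) / 2 ^ (g + h) =
        (if 0 \<le> y \<and> y < 2 ^ g then 1 / 2 ^ (g + h) else 0) +
        (2 ^ (g + h) - 2 ^ g) / 2 ^ (g + h) * (of_bool ?B :: real)"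
      by (simp add: add_divide_distrib)
    also have "(2 ^ (g + h) - 2 ^ g) / 2 ^ (g + h) = 1 - 1 / (2 ^ h :: real)"
      by (simp add: diff_divide_distrib power_add)
    finally show ?thesis .
  qed
  have "pmf (noisy_count w g h c) y =
      (\<Sum>u<2^w. ((if 0 \<le> y \<and> y < 2 ^ g then 1 / 2 ^ (g + h) else 0) +
      (1 - 1 / 2 ^ h) * of_bool (int ((c + u) div 2 ^ w) = y))) / 2 ^ w"
    by (simp add: noisy_count_def pmf_bind unif_eq[of w] integral_pmf_of_set ne inner)
  also have "\<dots> = (if 0 \<le> y \<and> y < 2 ^ g then 1 / 2 ^ (g + h) else 0) +
      (1 - 1 / 2 ^ h) * ((\<Sum>u<2^w. of_bool (int ((c + u) div 2 ^ w) = y)) / 2 ^ w)"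
    by (simp add: sum.distrib sum_distrib_left[symmetric] add_divide_distrib)
  also have "(\<Sum>u<2^w. of_bool (int ((c + u) div 2 ^ w) = y)) =
      real (card {u. u < 2 ^ w \<and> int ((c + u) div 2 ^ w) = y})"
    by (simp add: of_bool_def sum.If_cases) (auto intro!: arg_cong[of _ _ card])
  finally show ?thesis by (simp only: rounding_weight_def)
qed

text \<open>The weight is the share of the window from \<open>c\<close> to
  \<open>c + 2^w - 1\<close> that lies in the block with quotient \<open>y\<close>. Moving the
  window by one loses one point and gains one.\<close>

lemma rounding_weight_Lipschitz:
  "rounding_weight w c y \<le> rounding_weight w (Suc c) y + 1 / 2 ^ w"
  "rounding_weight w (Suc c) y \<le> rounding_weight w c y + 1 / 2 ^ w"
proof -
  define A where "A c = {x. c \<le> x \<and> x < c + 2 ^ w \<and> int (x div 2 ^ w) = y}" for c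
  have fin: "finite (A c)" for c by (rule finite_subset[of _ "{..<c + 2 ^ w}"]) (auto simp: A_def)
  have rw: "rounding_weight w c y = real (card (A c)) / 2 ^ w" for c
  proof -
    have "A c = (+) c ` {u. u < 2 ^ w \<and> int ((c + u) div 2 ^ w) = y}"
    proof (intro set_eqI iffI)
      fix x assume x: "x \<in> A c"
      then have "x = c + (x - c)" by (simp add: A_def)
      with x show "x \<in> (+) c ` {u. u < 2 ^ w \<and> int ((c + u) div 2 ^ w) = y}"
        by (intro image_eqI[of _ _ "x - c"]) (auto simp: A_def)
    qed (auto simp: A_def)
    then show ?thesis by (simp add: rounding_weight_def card_image)
  qed
  have "card (A c) \<le> card (insert c (A (Suc c)))"
    using fin by (intro card_mono) (auto simp: A_def)
  also have "\<dots> \<le> card (A (Suc c)) + 1" by (simp add: card_insert_le_m1 card_insert_if fin)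
  finally have 1: "real (card (A c)) \<le> real (card (A (Suc c))) + 1" by linarith
  have "card (A (Suc c)) \<le> card (insert (c + 2 ^ w) (A c))"
    using fin by (intro card_mono) (auto simp: A_def)
  also have "\<dots> \<le> card (A c) + 1" by (simp add: card_insert_if fin)
  finally have 2: "real (card (A (Suc c))) \<le> real (card (A c)) + 1" by linarith
  show "rounding_weight w c y \<le> rounding_weight w (Suc c) y + 1 / 2 ^ w"
    "rounding_weight w (Suc c) y \<le> rounding_weight w c y + 1 / 2 ^ w"
    using 1 2 by (simp_all add: rw divide_right_mono flip: add_divide_distrib)
qed

text \<open>The second assumption makes the grid wide enough for every rounded count. Off the grid
  there is no floor probability, and a multiplicative guarantee would fail if anything were output
  there.\<close>

lemma rounding_weight_eq_0:
  assumes "c \<le> n" "n + 2 ^ w \<le> 2 ^ g * 2 ^ w" "\<not> (0 \<le> y \<and> y < 2 ^ g)"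
  shows "rounding_weight w c y = 0"
proof -
  have "int ((c + u) div 2 ^ w) \<noteq> y" if "u < 2 ^ w" for u
  proof
    assume y: "int ((c + u) div 2 ^ w) = y"
    have "c + u < 2 ^ g * 2 ^ w" using that assms by linarith
    then have "(c + u) div 2 ^ w < 2 ^ g" by (simp add: div_less_iff_less_mult)
    then have "y < 2 ^ g" using y by (metis of_nat_less_iff of_nat_numeral of_nat_power)
    then show False using y assms by auto
  qed
  then show ?thesis by (auto simp: rounding_weight_def)
qed

text \<open>Changing the count by one costs at most \<open>2^-w\<close> additively; measured against
  the floor \<open>2^-(g+h)\<close> this is a factor \<open>1 + 2^(g+h) / 2^w\<close>, at most the
  exponential.\<close>

lemma pmf_noisy_count_le:
  assumes "c \<le> n" "c' \<le> n" "c \<le> Suc c'" "c' \<le> Suc c" "n + 2 ^ w \<le> 2 ^ g * 2 ^ w"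
  shows "pmf (noisy_count w g h c) y \<le> exp (2 ^ (g + h) / 2 ^ w) * pmf (noisy_count w g h c') y"
proof (cases "0 \<le> y \<and> y < 2 ^ g")
  case True
  have "c = c' \<or> c = Suc c' \<or> c' = Suc c" using assms by linarith
  then have "rounding_weight w c y \<le> rounding_weight w c' y + 1 / 2 ^ w"
    using rounding_weight_Lipschitz by auto
  then have "(1 - 1 / 2 ^ h) * rounding_weight w c y \<le> (1 - 1 / 2 ^ h) * (rounding_weight w c' y + 1 / 2 ^ w)"
    by (intro mult_left_mono) auto
  also have "\<dots> \<le> (1 - 1 / 2 ^ h) * rounding_weight w c' y + 1 / 2 ^ w"
    by (simp add: algebra_simps)
  finally have "pmf (noisy_count w g h c) y \<le> pmf (noisy_count w g h c') y + 1 / 2 ^ w"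
    using True by (simp add: pmf_noisy_count)
  also have "1 / 2 ^ w = 2 ^ (g + h) / 2 ^ w * (1 / 2 ^ (g + h) :: real)" by simp
  also have "\<dots> \<le> 2 ^ (g + h) / 2 ^ w * pmf (noisy_count w g h c') y"
    using True by (intro mult_left_mono) (auto simp: pmf_noisy_count rounding_weight_def)
  also have "pmf (noisy_count w g h c') y + \<dots> = (1 + 2 ^ (g + h) / 2 ^ w) * pmf (noisy_count w g h c') y"
    by (simp add: algebra_simps)
  also have "\<dots> \<le> exp (2 ^ (g + h) / 2 ^ w) * pmf (noisy_count w g h c') y"
    by (intro mult_right_mono exp_ge_add_one_self) auto
  finally show ?thesis by simp
next
  case False
  then have "pmf (noisy_count w g h c) y = 0"
    using rounding_weight_eq_0[OF assms(1,5)] by (simp only: pmf_noisy_count) simp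
  then show ?thesis by simp
qed

lemma noisy_counts_Cons_pair:
  "noisy_counts w g h (c # cs) =
     map_pmf (\<lambda>(y, ys). y # ys) (pair_pmf (noisy_count w g h c) (noisy_counts w g h cs))"
  by (simp add: pair_pmf_def map_bind_pmf map_pmf_def bind_return_pmf bind_assoc_pmf)

lemma pmf_noisy_counts_Cons:
  "pmf (noisy_counts w g h (c # cs)) ys =
     (case ys of [] \<Rightarrow> 0 | y # ys' \<Rightarrow> pmf (noisy_count w g h c) y * pmf (noisy_counts w g h cs) ys')"
proof (cases ys)
  case Nil
  have "[] \<notin> set_pmf (noisy_counts w g h (c # cs))" unfolding noisy_counts_Cons_pair by auto
  then show ?thesis using Nil by (simp add: set_pmf_iff del: noisy_counts.simps)
next
  case (Cons y ys')
  have "inj (\<lambda>(y :: int, ys). y # ys)" by (auto simp: inj_def)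
  from pmf_map_inj'[OF this, of _ "(y, ys')"] show ?thesis
    unfolding noisy_counts_Cons_pair Cons by (simp add: pmf_pair)
qed

text \<open>The counts are perturbed independently, so the factors multiply. Every entry may differ
  by one, since a single row can affect all counts.\<close>

lemma pmf_noisy_counts_le:
  assumes "list_all2 (\<lambda>c c'. c \<le> n \<and> c' \<le> n \<and> c \<le> Suc c' \<and> c' \<le> Suc c) cs cs'"
    and "n + 2 ^ w \<le> 2 ^ g * 2 ^ w"
  shows "pmf (noisy_counts w g h cs) ys \<le>
    exp (real (length cs) * (2 ^ (g + h) / 2 ^ w)) * pmf (noisy_counts w g h cs') ys"
  using assms(1)
proof (induction arbitrary: ys rule: list_all2_induct)
  case (Cons c cs c' cs')
  show ?case
  proof (cases ys)
    case (Cons y ys')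
    let ?e = "2 ^ (g + h) / 2 ^ w :: real"
    have len: "real (length (c # cs)) * ?e = ?e + real (length cs) * ?e"
      by (simp add: add_divide_distrib distrib_right)
    have "pmf (noisy_count w g h c) y * pmf (noisy_counts w g h cs) ys' \<le>
      (exp ?e * pmf (noisy_count w g h c') y) *
      (exp (real (length cs) * ?e) * pmf (noisy_counts w g h cs') ys')"
      using Cons.IH Cons.hyps assms(2) by (intro mult_mono pmf_noisy_count_le) auto
    also have "\<dots> = exp (real (length (c # cs)) * ?e) *
        (pmf (noisy_count w g h c') y * pmf (noisy_counts w g h cs') ys')"
      by (simp only: len exp_add mult_ac)
    finally show ?thesis by (simp only: pmf_noisy_counts_Cons Cons list.case)
  qed (simp add: pmf_noisy_counts_Cons del: noisy_counts.simps)
qed auto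

text \<open>An output that is not a rounding of \<open>c\<close> can only come from the replacement.
  The companion lemma for lists is the union bound.\<close>

lemma prob_noisy_count_inaccurate:
  "measure_pmf.prob (noisy_count w g h c) {y. \<not> (\<exists>u<2^w. y = int ((c + u) div 2 ^ w))} \<le> 1 / 2 ^ h"
proof -
  let ?f = "\<lambda>(u, v). if v < 2 ^ g then int v else int ((c + u) div 2 ^ w)"
  let ?U = "pair_pmf (unif w) (unif (g + h))"
  have e: "noisy_count w g h c = map_pmf ?f ?U"
    by (simp add: noisy_count_def pair_pmf_def map_bind_pmf map_pmf_def bind_return_pmf bind_assoc_pmf)
  have "measure_pmf.prob (noisy_count w g h c) {y. \<not> (\<exists>u<2^w. y = int ((c + u) div 2 ^ w))} =
      measure_pmf.prob ?U (?f -` {y. \<not> (\<exists>u<2^w. y = int ((c + u) div 2 ^ w))})"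
    by (simp only: e measure_map_pmf)
  also have "\<dots> \<le> measure_pmf.prob ?U (snd -` {v. v < 2 ^ g})"
    by (intro measure_pmf.finite_measure_mono_AE)
       (auto simp: AE_measure_pmf_iff unif_eq[of w] set_pmf_of_set lessThan_empty_iff)
  also have "\<dots> = 1 / 2 ^ h"
    by (simp only: measure_map_pmf[symmetric] map_snd_pair_pmf prob_unif_lessThan)
  finally show ?thesis .
qed

lemma prob_noisy_counts_inaccurate:
  "measure_pmf.prob (noisy_counts w g h cs)
     {ys. \<not> list_all2 (\<lambda>c y. \<exists>u<2^w. y = int ((c + u) div 2 ^ w)) cs ys} \<le> real (length cs) / 2 ^ h"
proof (induction cs)
  case (Cons c cs)
  let ?Q = "\<lambda>c y. \<exists>u<2^w. y = int ((c + u) div 2 ^ w)"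
  let ?p = "noisy_count w g h c" and ?r = "noisy_counts w g h cs"
  let ?B = "{y. \<not> ?Q c y}" and ?Bs = "{ys. \<not> list_all2 ?Q cs ys}"
  have "measure_pmf.prob (noisy_counts w g h (c # cs)) {ys. \<not> list_all2 ?Q (c # cs) ys} =
      measure_pmf.prob (pair_pmf ?p ?r) ((\<lambda>(y, ys). y # ys) -` {ys. \<not> list_all2 ?Q (c # cs) ys})"
    by (simp only: noisy_counts_Cons_pair measure_map_pmf)
  also have "\<dots> \<le> measure_pmf.prob (pair_pmf ?p ?r) (fst -` ?B \<union> snd -` ?Bs)"
    by (intro measure_pmf.finite_measure_mono) auto
  also have "\<dots> \<le> measure_pmf.prob (pair_pmf ?p ?r) (fst -` ?B) + measure_pmf.prob (pair_pmf ?p ?r) (snd -` ?Bs)"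
    by (intro measure_Un_le) auto
  also have "\<dots> = measure_pmf.prob ?p ?B + measure_pmf.prob ?r ?Bs"
    by (simp only: measure_map_pmf[symmetric] map_snd_pair_pmf map_fst_pair_pmf)
  also have "\<dots> \<le> 1 / 2 ^ h + real (length cs) / 2 ^ h"
    by (intro add_mono Cons.IH prob_noisy_count_inaccurate)
  finally show ?case by (simp add: add_divide_distrib)
qed simp

subsection \<open>The sanitizer and the evaluator\<close>

type_synonym literal = "nat \<times> bool"

definition violates :: "bool list \<Rightarrow> literal \<Rightarrow> bool" where
  "violates x l \<longleftrightarrow> x ! fst l \<noteq> snd l"

definition violation_count :: "database \<Rightarrow> literal list \<Rightarrow> nat" where
  "violation_count D \<tau> = card {i. i < length D \<and> list_all (violates (D ! i)) \<tau>}"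

lemma violation_count_le: "violation_count D \<tau> \<le> length D"
proof -
  have "violation_count D \<tau> \<le> card {..<length D}"
    unfolding violation_count_def by (intro card_mono) auto
  then show ?thesis by simp
qed

lemma nth_concat_uniform:
  assumes "\<forall>x\<in>set D. length x = d" "i < length D" "j < d"
  shows "concat D ! (i * d + j) = D ! i ! j"
  using assms
proof (induction D arbitrary: i)
  case (Cons x D)
  then show ?case by (cases i) (simp_all add: nth_append)
qed simp

lemma length_concat_uniform:
  "\<forall>x\<in>set D. length x = d \<Longrightarrow> length (concat D) = length D * d"
  by (induction D) auto

lemma input_cell_encode_database:
  assumes "D \<in> databases n d" "i < n" "j < d"
  shows "input_cell (encode_database D) (int (i * d + j)) = of_bool (D ! i ! j)"
proof -
  have D: "length D = n" "\<forall>x\<in>set D. length x = d" using assms by (auto simp: databases_def)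
  have "i * d + j < Suc i * d" using assms(3) by simp
  also have "\<dots> \<le> n * d" using assms(2) by (intro mult_le_mono1) simp
  finally have len: "i * d + j < length (concat D)" by (simp only: length_concat_uniform[OF D(2)] D(1))
  have "nat (int (i * d + j)) = i * d + j" by (rule nat_int)
  then have "input_cell (encode_database D) (int (i * d + j)) = of_bool (concat D ! (i * d + j))"
    using len by (simp only: input_cell_def encode_database_def length_map nth_map of_nat_less_iff of_nat_0_le_iff simp_thms if_True)
  then show ?thesis using nth_concat_uniform[OF D(2), of i j] assms D by simp
qed

text \<open>Violation is the bit itself if the literal demands \<open>False\<close>, and one minus
  the bit otherwise, cell 2 holding 1. The address is a constant of the unrolled code.\<close>

definition row_literal_code :: "nat \<Rightarrow> nat \<Rightarrow> literal \<Rightarrow> program" where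
  "row_literal_code d i l =
     [Const 4 (int (i * d + fst l)), Read 4 4] @ (if snd l then [Sub 4 2 4] else [])"

definition count_code :: "nat \<Rightarrow> nat \<Rightarrow> literal list \<Rightarrow> program" where
  "count_code d n \<tau> =
     concat (map (\<lambda>i. conj_code (row_literal_code d i) \<tau> @ [Add 5 5 3, Const 3 0]) [0..<n])"

lemma run_count_code:
  assumes D: "D \<in> databases n d" and \<tau>: "\<forall>l\<in>set \<tau>. fst l < d"
    and m: "m 0 = 0" "m 1 = 0" "m 2 = 1" "m 3 = 0" "m 4 = 0" "m 5 = 0"
  shows "run (encode_database D) (count_code d n \<tau>) (m, z) =
           return_pmf (m(5 := int (violation_count D \<tau>)), z)"
proof -
  let ?xs = "encode_database D"
  let ?c = "\<lambda>n'. int (card {i. i < n' \<and> list_all (violates (D ! i)) \<tau>})"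
  have "run ?xs (count_code d n' \<tau>) (m, z) = return_pmf (m(5 := ?c n'), z)" if "n' \<le> n" for n'
    using that
  proof (induction n')
    case 0
    have "m(5 := 0) = m" using m by (simp add: fun_upd_idem)
    then show ?case by (simp add: count_code_def del: fun_upd_apply)
  next
    case (Suc n')
    let ?M = "m(5 := ?c n')" and ?b = "list_all (violates (D ! n')) \<tau>"
    have lit: "run ?xs (row_literal_code d n' l) (?M(3 := of_bool b), z) =
        return_pmf (?M(3 := of_bool b, 4 := of_bool (violates (D ! n') l)), z)" if "l \<in> set \<tau>" for l b
    proof -
      have "input_cell ?xs (int n' * int d + int (fst l)) = of_bool (D ! n' ! fst l)"
        using input_cell_encode_database[OF D, of n' "fst l"] \<tau> that Suc.prems by simp
      then show ?thesis using m
        by (simp add: row_literal_code_def violates_def bind_return_pmf fun_eq_iff)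
    qed
    have conj: "run ?xs (conj_code (row_literal_code d n') \<tau>) (?M, z) = return_pmf (?M(3 := of_bool ?b), z)"
      by (rule run_conj_code) (use lit m in auto)
    have "{i. i < Suc n' \<and> list_all (violates (D ! i)) \<tau>} =
        {i. i < n' \<and> list_all (violates (D ! i)) \<tau>} \<union> (if ?b then {n'} else {})"
      by (auto simp: less_Suc_eq)
    then have c: "?c (Suc n') = ?c n' + of_bool ?b" by (simp add: card_insert_if)
    have fin: "run ?xs [Add 5 5 3, Const 3 0] (?M(3 := of_bool ?b), z) = return_pmf (m(5 := ?c (Suc n')), z)"
      using m unfolding c by (auto simp: bind_return_pmf fun_eq_iff)
    have split: "count_code d (Suc n') \<tau> =
        count_code d n' \<tau> @ conj_code (row_literal_code d n') \<tau> @ [Add 5 5 3, Const 3 0]"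
      by (simp add: count_code_def)
    have "run ?xs (count_code d n' \<tau>) (m, z) = return_pmf (?M, z)"
      using Suc.prems by (intro Suc.IH) simp
    then show ?case unfolding split run_append by (simp only: bind_return_pmf conj fin)
  qed
  moreover have "length D = n" using D by (simp add: databases_def)
  ultimately show ?thesis by (simp add: violation_count_def)
qed

text \<open>Cells 9 to \<open>8 + n + 2\<^sup>w\<close> tabulate division by \<open>2\<^sup>w\<close>; they are followed by the
  table of the indicator function of \<open>{..<2\<^sup>g}\<close>.\<close>

definition sanitizer_table :: "nat \<Rightarrow> nat \<Rightarrow> nat \<Rightarrow> nat \<Rightarrow> int" where
  "sanitizer_table n w g i =
     (if i = 2 then 1 else if i < 9 then 0
      else if i < 9 + n + 2 ^ w then int ((i - 9) div 2 ^ w)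
      else if i < 9 + n + 2 ^ w + 2 ^ g then 1 else 0)"

text \<open>The rounded count and the uniform replacement are left in cells 5 and 6, and the table
  gives the offset of the one to be written.\<close>

definition noise_code :: "nat \<Rightarrow> nat \<Rightarrow> nat \<Rightarrow> nat \<Rightarrow> program" where
  "noise_code n w g h =
     unif_code w @ [Add 5 5 6, Const 6 9, Add 5 5 6, Load 5 5, Const 6 0] @
     unif_code (g + h) @
     [Const 7 (int (9 + n + 2 ^ w)), Add 7 7 6, Load 7 7, Const 8 5, Add 7 7 8, Load 7 7, Write 7,
      Const 5 0, Const 6 0, Const 7 0, Const 8 0]"

lemma run_noise_code:
  assumes "c \<le> n"
  shows "run xs (noise_code n w g h) ((sanitizer_table n w g)(5 := int c), z) =
           map_pmf (\<lambda>y. (sanitizer_table n w g, z @ [y])) (noisy_count w g h c)"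
proof -
  let ?M = "sanitizer_table n w g"
  let ?J = "\<lambda>u. int ((c + u) div 2 ^ w)"
  let ?P1 = "[Add 5 5 6, Const 6 9, Add 5 5 6, Load 5 5, Const 6 0]"
  let ?P2 = "[Const 7 (int (9 + n + 2 ^ w)), Add 7 7 6, Load 7 7, Const 8 5, Add 7 7 8, Load 7 7, Write 7,
      Const 5 0, Const 6 0, Const 7 0, Const 8 0]"
  have scratch: "?M 4 = 0" "?M 5 = 0" "?M 6 = 0" "?M 7 = 0" "?M 8 = 0"
    by (auto simp: sanitizer_table_def)
  have p1: "run xs ?P1 (?M(5 := int c, 6 := int u), z) = return_pmf (?M(5 := ?J u), z)"
    if "u < 2 ^ w" for u
  proof -
    have a: "nat (int c + int u + 9) = c + u + 9" by simp
    \<comment> \<open>The bounds \<open>c \<le> n\<close> and \<open>u < 2^w\<close> keep the index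
      inside the division table.\<close>
    have "?M (c + u + 9) = ?J u" using that assms by (simp add: sanitizer_table_def)
    then show ?thesis using scratch
      by (simp add: bind_return_pmf a fun_eq_iff)
  qed
  have p2: "run xs ?P2 (?M(5 := ?J u, 6 := int v), z) =
      return_pmf (?M, z @ [if v < 2 ^ g then int v else ?J u])" for u v
  proof -
    have a: "nat (int (9 + n + 2 ^ w) + int v) = 9 + n + 2 ^ w + v"
      by (simp only: of_nat_add[symmetric] nat_int)
    have "?M (9 + n + 2 ^ w + v) = of_bool (v < 2 ^ g)" by (simp add: sanitizer_table_def)
    moreover have "9 + n + 2 ^ w + v \<noteq> i" if "i < 9" for i using that by linarith
    ultimately show ?thesis using scratch a
      by (simp add: bind_return_pmf fun_eq_iff del: of_nat_add)
  qed
  have u1: "run xs (unif_code w) (?M(5 := int c), z) = map_pmf (\<lambda>u. (?M(5 := int c, 6 := int u), z)) (unif w)"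
    by (rule run_unif_code) (use scratch in auto)
  have u2: "run xs (unif_code (g + h)) (?M(5 := ?J u), z) = map_pmf (\<lambda>v. (?M(5 := ?J u, 6 := int v), z)) (unif (g + h))" for u
    by (rule run_unif_code) (use scratch in auto)
  have lt: "u < 2 ^ w" if "u \<in> set_pmf (unif w)" for u
    using that by (simp add: unif_eq lessThan_empty_iff)
  have "run xs (noise_code n w g h) (?M(5 := int c), z) =
      bind_pmf (unif w) (\<lambda>u. bind_pmf (run xs ?P1 (?M(5 := int c, 6 := int u), z))
        (\<lambda>s. bind_pmf (run xs (unif_code (g + h)) s) (run xs ?P2)))"
    unfolding noise_code_def run_append u1 bind_map_pmf ..
  also have "\<dots> = bind_pmf (unif w) (\<lambda>u. map_pmf (\<lambda>v. (?M, z @ [if v < 2 ^ g then int v else ?J u])) (unif (g + h)))"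
    by (intro bind_pmf_cong refl) (simp only: p1 lt bind_return_pmf u2 bind_map_pmf p2, simp only: map_pmf_def)
  also have "\<dots> = map_pmf (\<lambda>y. (?M, z @ [y])) (noisy_count w g h c)"
    by (simp add: noisy_count_def map_bind_pmf map_pmf_comp)
  finally show ?thesis .
qed

definition sanitizer_code :: "nat \<Rightarrow> nat \<Rightarrow> nat \<Rightarrow> nat \<Rightarrow> nat \<Rightarrow> literal list list \<Rightarrow> program" where
  "sanitizer_code d n w g h L =
     map (\<lambda>i. Const i (sanitizer_table n w g i)) [0..<9 + n + 2 ^ w + 2 ^ g] @
     concat (map (\<lambda>\<tau>. count_code d n \<tau> @ noise_code n w g h) L)"

lemma run_sanitizer_code:
  assumes D: "D \<in> databases n d" and L: "\<forall>\<tau>\<in>set L. \<forall>l\<in>set \<tau>. fst l < d"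
  shows "map_pmf snd (run (encode_database D) (sanitizer_code d n w g h L) (\<lambda>_. 0, [])) =
           noisy_counts w g h (map (violation_count D) L)"
proof -
  let ?xs = "encode_database D" and ?M = "sanitizer_table n w g"
  \<comment> \<open>Untouched memory is 0, the right indicator value for draws from
    \<open>2^g\<close> on, so only \<open>2^g\<close> instead of \<open>2^(g+h)\<close> entries have
    to be written.\<close>
  have tab: "(\<lambda>i. if i < 9 + n + 2 ^ w + 2 ^ g then ?M i else 0) = ?M"
    by (auto simp: sanitizer_table_def fun_eq_iff)
  have cn: "violation_count D \<tau> \<le> n" for \<tau>
    using violation_count_le[of D \<tau>] D by (simp add: databases_def)
  have "run ?xs (concat (map (\<lambda>\<tau>. count_code d n \<tau> @ noise_code n w g h) L)) (?M, z) =
      map_pmf (\<lambda>ys. (?M, z @ ys)) (noisy_counts w g h (map (violation_count D) L))" for z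
    using L
  proof (induction L arbitrary: z)
    case (Cons \<tau> L)
    have cc: "run ?xs (count_code d n \<tau>) (?M, z) = return_pmf (?M(5 := int (violation_count D \<tau>)), z)"
      using Cons.prems by (intro run_count_code D) (auto simp: sanitizer_table_def)
    have "run ?xs (concat (map (\<lambda>\<tau>. count_code d n \<tau> @ noise_code n w g h) L)) (?M, z) =
      map_pmf (\<lambda>ys. (?M, z @ ys)) (noisy_counts w g h (map (violation_count D) L))" for z
      using Cons by simp
    then show ?case
      by (simp add: run_append cc bind_return_pmf run_noise_code[OF cn] bind_map_pmf map_bind_pmf map_pmf_comp
          del: fun_upd_apply)
  qed simp
  then show ?thesis
    unfolding sanitizer_code_def run_append run_Const_table tab bind_return_pmf
    by (simp add: map_pmf_comp)
qed

section \<open>The evaluator program\<close>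

definition meets :: "marginal_query \<Rightarrow> literal \<Rightarrow> bool" where
  "meets q l \<longleftrightarrow> q (fst l) = Some (snd l)"

text \<open>Cells 9 to 11 and 12 to 14 tabulate, over the symbols \<open>-1, 0, 1\<close>, equality with \<open>0\<close>
  and with \<open>1\<close>.\<close>

definition evaluator_table :: "nat \<Rightarrow> int" where
  "evaluator_table i = of_bool (i = 2 \<or> i = 10 \<or> i = 14)"

text \<open>10 and 13 are the cells of the symbol 0 in the two tables; adding the symbol -1, 0 or 1
  reaches the neighbouring entries.\<close>

definition query_literal_code :: "literal \<Rightarrow> program" where
  "query_literal_code l =
     [Const 4 (int (fst l)), Read 4 4, Const 7 (if snd l then 13 else 10), Add 4 4 7, Const 7 0, Load 4 4]"

text \<open>Repeated addition replaces multiplication, so the size of the coefficients enters the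
  running time of the evaluator.\<close>

definition multiple_code :: "int \<Rightarrow> program" where
  "multiple_code a = replicate (nat \<bar>a\<bar>) (if 0 \<le> a then Add 8 8 4 else Sub 8 8 4)"

lemma run_multiple_code:
  "run xs (multiple_code a) (m, z) = return_pmf (m(8 := m 8 + a * m 4), z)"
proof -
  have p: "run xs (replicate r (Add 8 8 4)) (m, z) = return_pmf (m(8 := m 8 + int r * m 4), z)" for r m
    by (induction r arbitrary: m) (simp_all add: bind_return_pmf algebra_simps)
  have n: "run xs (replicate r (Sub 8 8 4)) (m, z) = return_pmf (m(8 := m 8 - int r * m 4), z)" for r m
    by (induction r arbitrary: m) (simp_all add: bind_return_pmf algebra_simps)
  show ?thesis by (cases "0 \<le> a") (simp_all add: multiple_code_def p n)
qed

text \<open>Cell 5 holds 0 and cell 6 the released count, so that loading from \<open>5 + b\<close> multiplies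
  the count by the bit \<open>b\<close>. The sum is accumulated in cell 8, as cell 0 is still needed for
  conjunctions.\<close>

definition term_code :: "nat \<Rightarrow> int \<Rightarrow> nat \<Rightarrow> literal list \<Rightarrow> program" where
  "term_code d a i \<tau> =
     conj_code query_literal_code \<tau> @
     [Const 6 (int (d + i)), Read 6 6, Const 4 5, Add 4 4 3, Load 4 4] @
     multiple_code a @ [Const 3 0, Const 4 0, Const 6 0]"

lemma input_cell_encode_query:
  "j < d \<Longrightarrow> input_cell (encode_query d q @ z) (int j) = (case q j of None \<Rightarrow> - 1 | Some b \<Rightarrow> of_bool b)"
  "input_cell (encode_query d q @ z) (int (d + i)) = input_cell z (int i)"
  by (auto simp: input_cell_def encode_query_def nth_append nat_add_distrib)

lemma run_term_code:
  assumes "\<forall>l\<in>set \<tau>. fst l < d"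
  shows "run (encode_query d q @ y) (term_code d a i \<tau>) (evaluator_table(8 := v), z) =
    return_pmf (evaluator_table(8 := v + a * of_bool (list_all (meets q) \<tau>) * input_cell y (int i)), z)"
proof -
  let ?xs = "encode_query d q @ y" and ?M = "evaluator_table(8 := v)"
  let ?b = "list_all (meets q) \<tau>"
  have lit: "run ?xs (query_literal_code l) (?M(3 := of_bool b), z) =
      return_pmf (?M(3 := of_bool b, 4 := of_bool (meets q l)), z)" if "l \<in> set \<tau>" for l b
  proof -
    have "input_cell ?xs (int (fst l)) = (case q (fst l) of None \<Rightarrow> - 1 | Some b \<Rightarrow> of_bool b)"
      using that assms by (intro input_cell_encode_query) auto
    then show ?thesis
      by (cases "q (fst l)"; cases "snd l")
        (auto simp: query_literal_code_def meets_def evaluator_table_def bind_return_pmf fun_eq_iff)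
  qed
  have conj: "run ?xs (conj_code query_literal_code \<tau>) (?M, z) = return_pmf (?M(3 := of_bool ?b), z)"
    by (rule run_conj_code) (use lit in \<open>auto simp: evaluator_table_def\<close>)
  let ?N = "?M(3 := of_bool ?b, 6 := input_cell y (int i), 4 := of_bool ?b * input_cell y (int i))"
  have load: "run ?xs [Const 6 (int (d + i)), Read 6 6, Const 4 5, Add 4 4 3, Load 4 4] (?M(3 := of_bool ?b), z) =
      return_pmf (?N, z)"
    by (auto simp: bind_return_pmf input_cell_encode_query evaluator_table_def fun_eq_iff simp del: of_nat_add)
  have fin: "run ?xs [Const 3 0, Const 4 0, Const 6 0] (?N(8 := ?N 8 + a * ?N 4), z) =
      return_pmf (evaluator_table(8 := v + a * of_bool ?b * input_cell y (int i)), z)"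
    by (auto simp: bind_return_pmf evaluator_table_def fun_eq_iff)
  show ?thesis unfolding term_code_def run_append
    by (simp only: conj load bind_return_pmf run_multiple_code fin)
qed

definition evaluator_code :: "nat \<Rightarrow> (literal list \<Rightarrow> int) \<Rightarrow> literal list list \<Rightarrow> program" where
  "evaluator_code d a L =
     map (\<lambda>i. Const i (evaluator_table i)) [0..<15] @
     concat (map (\<lambda>i. term_code d (a (L ! i)) i (L ! i)) [0..<length L]) @ [Add 0 8 1]"

text \<open>Uses \<open>input_cell\<close>, which is 0 out of range, because the evaluator has to be
  specified on every summary, including those that are too short.\<close>

definition evaluator_sum ::
    "(literal list \<Rightarrow> int) \<Rightarrow> literal list list \<Rightarrow> int list \<Rightarrow> marginal_query \<Rightarrow> int" where
  "evaluator_sum a L y q =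
     (\<Sum>i<length L. a (L ! i) * of_bool (list_all (meets q) (L ! i)) * input_cell y (int i))"

lemma run_evaluator_code:
  assumes "\<forall>\<tau>\<in>set L. \<forall>l\<in>set \<tau>. fst l < d"
  shows "\<exists>m z. run (encode_query d q @ y) (evaluator_code d a L) (\<lambda>_. 0, []) = return_pmf (m, z) \<and>
    m 0 = evaluator_sum a L y q"
proof -
  let ?xs = "encode_query d q @ y"
  let ?S = "\<lambda>r. \<Sum>i<r. a (L ! i) * of_bool (list_all (meets q) (L ! i)) * input_cell y (int i)"
  have tab: "(\<lambda>i. if i < 15 then evaluator_table i else 0) = evaluator_table"
    by (auto simp: evaluator_table_def fun_eq_iff)
  have "run ?xs (concat (map (\<lambda>i. term_code d (a (L ! i)) i (L ! i)) [0..<r])) (evaluator_table, []) =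
      return_pmf (evaluator_table(8 := ?S r), [])" if "r \<le> length L" for r
    using that
  proof (induction r)
    case 0
    have "evaluator_table(8 := 0) = evaluator_table"
      by (auto simp: evaluator_table_def fun_eq_iff)
    then show ?case by (simp del: fun_upd_apply)
  next
    case (Suc r)
    have "\<forall>l\<in>set (L ! r). fst l < d" using assms Suc.prems by (metis Suc_le_lessD nth_mem)
    then show ?case using Suc
      by (simp add: run_append bind_return_pmf run_term_code bind_return_pmf' del: fun_upd_apply)
  qed
  from this[of "length L"]
  have "run ?xs (evaluator_code d a L) (\<lambda>_. 0, []) =
      return_pmf (evaluator_table(8 := ?S (length L), 0 := ?S (length L)), [])"
    unfolding evaluator_code_def run_append run_Const_table tab bind_return_pmf
    by (simp add: bind_return_pmf evaluator_table_def)
  then show ?thesis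
    by (intro exI conjI, assumption) (simp add: evaluator_sum_def)
qed

section \<open>Length and shape of the two programs\<close>

lemma length_unif_code: "length (unif_code w) = 4 * w"
  by (induction w) auto

lemma length_conj_code:
  assumes "\<And>l. length (lc l) \<le> c"
  shows "length (conj_code lc \<tau>) \<le> 1 + (c + 3) * length \<tau>"
proof -
  have "length (concat (map (\<lambda>l. lc l @ [Add 3 3 4, Const 4 0, Load 3 3]) \<tau>)) \<le> (c + 3) * length \<tau>"
    by (induction \<tau>) (use assms in \<open>auto intro!: add_mono\<close>)
  then show ?thesis by (simp add: conj_code_def)
qed

lemma length_concat_map_le:
  assumes "\<And>x. x \<in> set xs \<Longrightarrow> length (f x) \<le> b"
  shows "length (concat (map f xs)) \<le> length xs * b"
  using assms by (induction xs) (auto intro!: add_mono)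

lemma length_sanitizer_code:
  assumes "\<forall>\<tau>\<in>set L. length \<tau> \<le> t"
  shows "length (sanitizer_code d n w g h L) \<le>
    9 + n + 2 ^ w + 2 ^ g + length L * (n * (3 + 6 * t) + 4 * (w + g + h) + 16)"
proof -
  have row: "length (conj_code (row_literal_code d i) \<tau> @ [Add 5 5 3, Const 3 0]) \<le> 3 + 6 * t"
    if "\<tau> \<in> set L" for i \<tau>
  proof -
    have "length (conj_code (row_literal_code d i) \<tau>) \<le> 1 + (3 + 3) * length \<tau>"
      by (rule length_conj_code) (simp add: row_literal_code_def)
    moreover have "length \<tau> \<le> t" using assms that by simp
    ultimately show ?thesis by simp
  qed
  have "length (count_code d n \<tau>) \<le> n * (3 + 6 * t)" if "\<tau> \<in> set L" for \<tau>
    using length_concat_map_le[of "[0..<n]" _ "3 + 6 * t", OF row[OF that]] by (simp add: count_code_def)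
  then have "length (concat (map (\<lambda>\<tau>. count_code d n \<tau> @ noise_code n w g h) L)) \<le>
      length L * (n * (3 + 6 * t) + 4 * (w + g + h) + 16)"
    by (intro length_concat_map_le) (auto simp: noise_code_def length_unif_code algebra_simps)
  then show ?thesis by (simp add: sanitizer_code_def)
qed

lemma length_evaluator_code:
  assumes "\<forall>\<tau>\<in>set L. length \<tau> \<le> t \<and> nat \<bar>a \<tau>\<bar> \<le> b"
  shows "length (evaluator_code d a L) \<le> 16 + length L * (9 + 9 * t + b)"
proof -
  have "length (term_code d (a \<tau>) i \<tau>) \<le> 9 + 9 * t + b" if "\<tau> \<in> set L" for \<tau> i
  proof -
    have "length (conj_code query_literal_code \<tau>) \<le> 1 + (6 + 3) * length \<tau>"
      by (rule length_conj_code) (simp add: query_literal_code_def)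
    moreover have "length \<tau> \<le> t" "nat \<bar>a \<tau>\<bar> \<le> b" using assms that by auto
    ultimately show ?thesis by (simp add: term_code_def multiple_code_def)
  qed
  then have "length (concat (map (\<lambda>i. term_code d (a (L ! i)) i (L ! i)) [0..<length L])) \<le>
      length [0..<length L] * (9 + 9 * t + b)"
    by (intro length_concat_map_le) auto
  then show ?thesis by (simp add: evaluator_code_def)
qed

lemma jump_free_unif_code: "list_all jump_free (unif_code w)"
  by (induction w) auto

lemma jump_free_conj_code:
  "(\<And>l. list_all jump_free (lc l)) \<Longrightarrow> list_all jump_free (conj_code lc \<tau>)"
  by (auto simp: conj_code_def list_all_iff)

lemma jump_free_sanitizer_code: "list_all jump_free (sanitizer_code d n w g h L)"
proof -
  have c: "list_all jump_free (conj_code (row_literal_code d i) \<tau>)" for i \<tau>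
    by (rule jump_free_conj_code) (simp add: row_literal_code_def)
  have "list_all jump_free (count_code d n \<tau>)" for \<tau>
    using c by (auto simp: count_code_def list_all_iff)
  moreover have "list_all jump_free (noise_code n w g h)"
    using jump_free_unif_code by (auto simp: noise_code_def list_all_iff)
  ultimately show ?thesis by (auto simp: sanitizer_code_def list_all_iff)
qed

lemma evaluator_code_instrs:
  "list_all (\<lambda>i. jump_free i \<and> (\<forall>r. i \<noteq> Coin r)) (evaluator_code d a L)"
  by (auto simp: evaluator_code_def term_code_def conj_code_def query_literal_code_def
      multiple_code_def list_all_iff split: if_splits)

subsection \<open>Accuracy and privacy\<close>

definition literals :: "nat \<Rightarrow> literal list" where
  "literals d = List.product [0..<d] [False, True]"

definition tuples :: "nat \<Rightarrow> nat \<Rightarrow> literal list list" where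
  "tuples d t = concat (map (\<lambda>r. List.n_lists r (literals d)) [0..<Suc t])"

lemma tuples_bounds:
  assumes "\<tau> \<in> set (tuples d t)"
  shows "length \<tau> \<le> t" "\<forall>l\<in>set \<tau>. fst l < d"
proof -
  obtain r where "r < Suc t" "\<tau> \<in> set (List.n_lists r (literals d))"
    using assms by (auto simp: tuples_def simp del: upt_Suc)
  then show "length \<tau> \<le> t" "\<forall>l\<in>set \<tau>. fst l < d"
    by (auto simp: set_n_lists literals_def)
qed

lemma sum_list_upt: "(\<Sum>r\<leftarrow>[0..<n]. f r) = (\<Sum>r<n. f r)" for f :: "nat \<Rightarrow> 'a :: comm_monoid_add"
  by (induction n) simp_all

lemma length_tuples_le:
  assumes "1 \<le> d"
  shows "length (tuples d t) \<le> (4 * d) ^ t"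
proof -
  have "length (literals d) = 2 * d" by (simp add: literals_def)
  then have "length (tuples d t) = (\<Sum>r<Suc t. (2 * d) ^ r)"
    unfolding tuples_def length_concat map_map comp_def length_n_lists sum_list_upt by simp
  also have "\<dots> \<le> (\<Sum>r<Suc t. (2 * d) ^ t)"
    using assms by (intro sum_mono power_increasing) auto
  also have "\<dots> = Suc t * (2 * d) ^ t" by simp
  also have "\<dots> \<le> 2 ^ t * (2 * d) ^ t"
    by (intro mult_right_mono Suc_leI less_exp) simp
  also have "\<dots> = (4 * d) ^ t" by (simp only: power_mult_distrib[symmetric]) simp
  finally show ?thesis .
qed

lemma sum_list_concat: "sum_list (concat xss) = (\<Sum>xs\<leftarrow>xss. sum_list xs)"
  by (induction xss) simp_all

lemma sum_list_map_nth: "(\<Sum>x\<leftarrow>xs. f x) = (\<Sum>i<length xs. f (xs ! i))"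
  by (simp add: sum_list_sum_nth atLeast0LessThan)

lemma sum_list_n_lists_all:
  "(\<Sum>\<tau>\<leftarrow>List.n_lists r xs. of_bool (list_all P \<tau>)) = ((\<Sum>l\<leftarrow>xs. of_bool (P l)) :: int) ^ r"
proof (induction r)
  case (Suc r)
  have inner: "(\<Sum>l\<leftarrow>xs. of_bool (P l \<and> Q)) = (\<Sum>l\<leftarrow>xs. of_bool (P l)) * (of_bool Q :: int)" for Q
    by (cases Q) auto
  have "(\<Sum>\<tau>\<leftarrow>List.n_lists (Suc r) xs. of_bool (list_all P \<tau>)) =
      (\<Sum>\<tau>\<leftarrow>List.n_lists r xs. (\<Sum>l\<leftarrow>xs. of_bool (P l)) * (of_bool (list_all P \<tau>) :: int))"
    by (simp add: sum_list_concat comp_def inner map_concat)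
  then show ?case by (simp add: sum_list_const_mult Suc)
qed simp

definition violated :: "marginal_query \<Rightarrow> bool list \<Rightarrow> nat" where
  "violated q x = card {j \<in> dom q. x ! j \<noteq> the (q j)}"

text \<open>Each attribute in the domain of \<open>q\<close> contributes exactly one literal that
  meets \<open>q\<close>.\<close>

lemma sum_literals_violated:
  assumes "q \<in> marginals d k"
  shows "(\<Sum>l\<leftarrow>literals d. of_bool (meets q l \<and> violates x l)) = int (violated q x)"
proof -
  have dist: "distinct (literals d)" by (simp add: literals_def distinct_product)
  have fin: "finite (dom q)" and dom: "dom q \<subseteq> {..<d}"
    using assms by (auto simp: marginals_def intro: finite_subset)
  have "(\<Sum>l\<leftarrow>literals d. of_bool (meets q l \<and> violates x l)) =
      int (card {l \<in> set (literals d). meets q l \<and> violates x l})"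
    using dist by (simp add: sum_list_distinct_conv_sum_set Int_def)
  also have "{l \<in> set (literals d). meets q l \<and> violates x l} =
      (\<lambda>j. (j, the (q j))) ` {j \<in> dom q. x ! j \<noteq> the (q j)}"
  proof (intro equalityI subsetI)
    fix l assume "l \<in> {l \<in> set (literals d). meets q l \<and> violates x l}"
    then show "l \<in> (\<lambda>j. (j, the (q j))) ` {j \<in> dom q. x ! j \<noteq> the (q j)}"
      by (intro image_eqI[of _ _ "fst l"]) (auto simp: meets_def violates_def prod_eq_iff)
  qed (use dom in \<open>auto simp: literals_def meets_def violates_def\<close>)
  also have "card \<dots> = violated q x"
    unfolding violated_def by (intro card_image) (auto simp: inj_on_def)
  finally show ?thesis .
qed

text \<open>Expands each \<open>v^r\<close> over tuples. The indicator of a tuple splits into a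
  factor depending only on the query and one depending only on the row, so the data can be
  summarised before the query is known.\<close>

lemma sum_tuples_cheb:
  assumes "q \<in> marginals d k"
  shows "(\<Sum>\<tau>\<leftarrow>tuples d t. cheb_coeff k' t (length \<tau>) * of_bool (list_all (meets q) \<tau>) * of_bool (list_all (violates x) \<tau>)) =
    cheb k' t (violated q x)"
proof -
  let ?P = "\<lambda>l. meets q l \<and> violates x l"
  have level: "(\<Sum>\<tau>\<leftarrow>List.n_lists r (literals d). cheb_coeff k' t (length \<tau>) *
        of_bool (list_all (meets q) \<tau>) * of_bool (list_all (violates x) \<tau>)) =
      cheb_coeff k' t r * int (violated q x) ^ r" for r
  proof -
    have "(\<Sum>\<tau>\<leftarrow>List.n_lists r (literals d). cheb_coeff k' t (length \<tau>) *
          of_bool (list_all (meets q) \<tau>) * of_bool (list_all (violates x) \<tau>)) =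
        (\<Sum>\<tau>\<leftarrow>List.n_lists r (literals d). cheb_coeff k' t r * of_bool (list_all ?P \<tau>))"
      by (intro arg_cong[of _ _ sum_list] map_cong)
         (auto simp: set_n_lists list_all_iff)
    also have "\<dots> = cheb_coeff k' t r * int (violated q x) ^ r"
      unfolding sum_list_const_mult sum_list_n_lists_all sum_literals_violated[OF assms] ..
    finally show ?thesis .
  qed
  have "(\<Sum>\<tau>\<leftarrow>tuples d t. cheb_coeff k' t (length \<tau>) * of_bool (list_all (meets q) \<tau>) * of_bool (list_all (violates x) \<tau>)) =
      (\<Sum>r\<leftarrow>[0..<Suc t]. cheb_coeff k' t r * int (violated q x) ^ r)"
    by (simp add: tuples_def map_concat sum_list_concat comp_def level del: upt_Suc)
  also have "\<dots> = (\<Sum>r\<le>t. cheb_coeff k' t r * int (violated q x) ^ r)"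
    by (simp only: sum_list_upt lessThan_Suc_atMost)
  finally show ?thesis by (simp add: sum_cheb_coeff)
qed

lemma sum_violation_count_cheb:
  assumes "q \<in> marginals d k"
  shows "(\<Sum>\<tau>\<leftarrow>tuples d t. cheb_coeff k' t (length \<tau>) * of_bool (list_all (meets q) \<tau>) * int (violation_count D \<tau>)) =
    (\<Sum>i<length D. cheb k' t (violated q (D ! i)))"
proof -
  have vc: "int (violation_count D \<tau>) = (\<Sum>i<length D. of_bool (list_all (violates (D ! i)) \<tau>))" for \<tau>
    by (simp add: violation_count_def Int_def)
  have "(\<Sum>\<tau>\<leftarrow>tuples d t. cheb_coeff k' t (length \<tau>) * of_bool (list_all (meets q) \<tau>) * int (violation_count D \<tau>)) =
     (\<Sum>\<tau>\<leftarrow>tuples d t. \<Sum>i<length D. cheb_coeff k' t (length \<tau>) * of_bool (list_all (meets q) \<tau>) * of_bool (list_all (violates (D ! i)) \<tau>))"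
    by (simp only: vc sum_distrib_left)
  also have "\<dots> = (\<Sum>i<length D. \<Sum>\<tau>\<leftarrow>tuples d t. cheb_coeff k' t (length \<tau>) * of_bool (list_all (meets q) \<tau>) * of_bool (list_all (violates (D ! i)) \<tau>))"
    by (simp only: sum_list_map_nth sum.swap[of _ "{..<length D}"])
  finally show ?thesis by (simp only: sum_tuples_cheb[OF assms])
qed

text \<open>Row by row: a row satisfying the query has \<open>v = 0\<close> and contributes exactly
  the normalising value; any other has \<open>v\<close> between 1 and \<open>k\<close> and
  contributes at most \<open>k^t\<close>.\<close>

lemma cheb_sum_approximates:
  assumes q: "q \<in> marginals d k" and k: "1 \<le> k" and \<alpha>: "0 < \<alpha>"
    and n: "length D = n" "1 \<le> n"
    and A0: "2 / \<alpha> * real k ^ t \<le> real_of_int (cheb k t 0)" 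
  shows "\<bar>real_of_int (\<Sum>i<n. cheb k t (violated q (D ! i))) - real_of_int (cheb k t 0) * (real n * query_value q D)\<bar>
    \<le> \<alpha> / 2 * (real n * real_of_int (cheb k t 0))"
proof -
  let ?A = "real_of_int (cheb k t 0)"
  have fin: "finite (dom q)" and ck: "card (dom q) \<le> k"
    using q by (auto simp: marginals_def intro: finite_subset)
  have kt: "real k ^ t \<le> \<alpha> / 2 * ?A"
    using A0 \<alpha> by (simp add: field_simps)
  let ?s = "\<lambda>i. of_bool (\<forall>j\<in>dom q. D ! i ! j = the (q j)) :: real"
  have qv: "real n * query_value q D = (\<Sum>i<n. ?s i)"
    using n by (simp add: query_value_def Int_def)
  have row: "\<bar>real_of_int (cheb k t (violated q (D ! i))) - ?A * ?s i\<bar> \<le> \<alpha> / 2 * ?A" for i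
  proof (cases "violated q (D ! i) = 0")
    case True
    then have "\<forall>j\<in>dom q. D ! i ! j = the (q j)" using fin by (auto simp: violated_def)
    moreover have "0 \<le> \<alpha> / 2 * ?A" using kt by (rule order_trans[rotated]) simp
    ultimately show ?thesis using True by simp
  next
    case False
    then have s0: "?s i = 0" using fin by (auto simp: violated_def)
    have "violated q (D ! i) \<le> k"
      unfolding violated_def using fin ck by (intro order_trans[OF card_mono ck]) auto
    then have "\<bar>cheb k t (violated q (D ! i))\<bar> \<le> int k ^ t"
      using False by (intro abs_cheb_le) auto
    then have "real_of_int \<bar>cheb k t (violated q (D ! i))\<bar> \<le> real_of_int (int k ^ t)" by linarith
    then show ?thesis using kt unfolding s0 by simp
  qed
  have "\<bar>real_of_int (\<Sum>i<n. cheb k t (violated q (D ! i))) - ?A * (real n * query_value q D)\<bar> =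
      \<bar>\<Sum>i<n. (real_of_int (cheb k t (violated q (D ! i))) - ?A * ?s i)\<bar>"
    unfolding qv by (simp only: of_int_sum sum_distrib_left sum_subtractf)
  also have "\<dots> \<le> (\<Sum>i<n. \<alpha> / 2 * ?A)"
    by (rule order_trans[OF sum_abs sum_mono]) (rule row)
  finally show ?thesis by (simp add: mult_ac)
qed

text \<open>The bound \<open>s - 1\<close> instead of \<open>s\<close> matters: for
  \<open>s = 1\<close> rounding is exact, the case used when \<open>n\<close> is too small for
  coarser rounding.\<close>

lemma abs_rounding_error:
  fixes c u s :: nat
  assumes "u < s"
  shows "\<bar>real s * real ((c + u) div s) - real c\<bar> \<le> real s - 1"
proof -
  have "s * ((c + u) div s) + (c + u) mod s = c + u" by (simp add: mult_div_mod_eq)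
  moreover have "(c + u) mod s < s" using assms by simp
  ultimately have "s * ((c + u) div s) \<le> c + (s - 1)" "c \<le> s * ((c + u) div s) + (s - 1)"
    using assms by linarith+
  then have "real s * real ((c + u) div s) \<le> real c + real (s - 1)"
    "real c \<le> real s * real ((c + u) div s) + real (s - 1)"
    by (simp_all only: of_nat_mult[symmetric] of_nat_add[symmetric] of_nat_le_iff)
  then show ?thesis using assms by (simp add: of_nat_diff)
qed

text \<open>The factor \<open>2^w\<close> scales the released quotients back to counts.\<close>

definition term_weight :: "nat \<Rightarrow> nat \<Rightarrow> nat \<Rightarrow> literal list \<Rightarrow> int" where
  "term_weight w k t \<tau> = 2 ^ w * cheb_coeff k t (length \<tau>)"

text \<open>Half of \<alpha> pays for the polynomial approximation and half for rounding;
  \<open>w\<close> bounds the latter by number of terms times largest coefficient times error per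
  count.\<close>

lemma evaluator_sum_accurate:
  assumes q: "q \<in> marginals d k" and k: "1 \<le> k" and \<alpha>: "0 < \<alpha>"
    and n: "length D = n" "1 \<le> n"
    and A0: "2 / \<alpha> * real k ^ t \<le> real_of_int (cheb k t 0)" 
    and w: "2 * real (length (tuples d t)) * (7 * real k) ^ t * (2 ^ w - 1) \<le> \<alpha> * real n"
    and z: "list_all2 (\<lambda>c y. \<exists>u<2^w. y = int ((c + u) div 2 ^ w)) (map (violation_count D) (tuples d t)) z"
  shows "\<bar>real_of_int (evaluator_sum (term_weight w k t) (tuples d t) z q) / real (n * nat (cheb k t 0)) - query_value q D\<bar> \<le> \<alpha>"
proof -
  let ?A = "real_of_int (cheb k t 0)" and ?L = "tuples d t" and ?Q = "query_value q D"
  let ?c = "\<lambda>i. cheb_coeff k t (length (?L ! i)) * of_bool (list_all (meets q) (?L ! i))"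
  have "0 < 2 / \<alpha> * real k ^ t" using \<alpha> k by simp
  then have "0 < ?A" using A0 by linarith
  then have A1: "1 \<le> ?A" by simp
  have den: "real (n * nat (cheb k t 0)) = real n * ?A" using A1 by simp
  have len: "length z = length ?L" using z by (auto dest: list_all2_lengthD)
  have err: "\<bar>2 ^ w * real_of_int (z ! i) - real (violation_count D (?L ! i))\<bar> \<le> 2 ^ w - 1"
    if "i < length ?L" for i
  proof -
    have "\<exists>u<2 ^ w. z ! i = int ((violation_count D (?L ! i) + u) div 2 ^ w)"
      using z that by (auto simp: list_all2_conv_all_nth)
    then obtain u where "u < 2 ^ w" "z ! i = int ((violation_count D (?L ! i) + u) div 2 ^ w)"
      by blast
    then show ?thesis using abs_rounding_error[of u "2 ^ w" "violation_count D (?L ! i)"] by simp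
  qed
  have ev: "real_of_int (evaluator_sum (term_weight w k t) ?L z q) =
      (\<Sum>i<length ?L. real_of_int (?c i) * (2 ^ w * real_of_int (z ! i)))"
    by (simp add: evaluator_sum_def term_weight_def input_cell_def len mult_ac)
  have ch: "real_of_int (\<Sum>i<n. cheb k t (violated q (D ! i))) =
      (\<Sum>i<length ?L. real_of_int (?c i) * real (violation_count D (?L ! i)))"
    unfolding n(1)[symmetric] sum_violation_count_cheb[OF q, symmetric]
    by (simp add: sum_list_map_nth)
  have "\<bar>real_of_int (evaluator_sum (term_weight w k t) ?L z q) - real_of_int (\<Sum>i<n. cheb k t (violated q (D ! i)))\<bar> =
     \<bar>\<Sum>i<length ?L. real_of_int (?c i) * (2 ^ w * real_of_int (z ! i) - real (violation_count D (?L ! i)))\<bar>"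
    unfolding ev ch by (simp only: right_diff_distrib sum_subtractf)
  also have "\<dots> \<le> (\<Sum>i<length ?L. (7 * real k) ^ t * (2 ^ w - 1))"
  proof (rule order_trans[OF sum_abs sum_mono])
    fix i assume "i \<in> {..<length ?L}"
    then have i: "i < length ?L" by simp
    have "\<bar>?c i\<bar> \<le> (7 * int k) ^ t"
      using abs_cheb_coeff_le[OF k, of t "length (?L ! i)"] by (auto simp: abs_mult)
    then have "real_of_int \<bar>?c i\<bar> \<le> real_of_int ((7 * int k) ^ t)" by linarith
    then have "\<bar>real_of_int (?c i)\<bar> \<le> (7 * real k) ^ t" by simp
    then show "\<bar>real_of_int (?c i) * (2 ^ w * real_of_int (z ! i) - real (violation_count D (?L ! i)))\<bar>
        \<le> (7 * real k) ^ t * (2 ^ w - 1)"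
      unfolding abs_mult using err[OF i] by (intro mult_mono) auto
  qed
  also have "\<dots> \<le> \<alpha> / 2 * real n" using w by simp
  \<comment> \<open>The normalising value is a positive integer, so dividing by it cannot enlarge
    the rounding error.\<close>
  also have "\<dots> \<le> \<alpha> / 2 * (real n * ?A)"
    using A1 \<alpha> n by (intro mult_left_mono) auto
  finally have "\<bar>real_of_int (evaluator_sum (term_weight w k t) ?L z q) - real_of_int (\<Sum>i<n. cheb k t (violated q (D ! i)))\<bar>
      \<le> \<alpha> / 2 * (real n * ?A)" .
  then have "\<bar>real_of_int (evaluator_sum (term_weight w k t) ?L z q) - ?A * (real n * ?Q)\<bar> \<le>
      \<alpha> / 2 * (real n * ?A) + \<alpha> / 2 * (real n * ?A)"
    using cheb_sum_approximates[OF q k \<alpha> n A0] by linarith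
  also have "\<dots> = \<alpha> * (real n * ?A)" by simp
  finally have *: "\<bar>real_of_int (evaluator_sum (term_weight w k t) ?L z q) - ?A * (real n * ?Q)\<bar> \<le> \<alpha> * (real n * ?A)" .
  have pos: "0 < real n * ?A" using A1 n by simp
  then have "n \<noteq> 0" "?A \<noteq> 0" using n A1 by auto
  then have "real_of_int (evaluator_sum (term_weight w k t) ?L z q) / (real n * ?A) - ?Q =
      (real_of_int (evaluator_sum (term_weight w k t) ?L z q) - ?A * (real n * ?Q)) / (real n * ?A)"
    by (simp add: diff_divide_distrib)
  then show ?thesis
    unfolding den using * pos by (simp only: abs_divide abs_of_pos pos_divide_le_eq)
qed

section \<open>Privacy of the released counts\<close>

lemma violation_count_adjacent:
  assumes "adjacent D D'"
  shows "violation_count D \<tau> \<le> Suc (violation_count D' \<tau>)"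
proof -
  let ?S = "\<lambda>D :: database. {i. i < length D \<and> list_all (violates (D ! i)) \<tau>}"
  have len: "length D = length D'" and "card {i. i < length D \<and> D ! i \<noteq> D' ! i} = 1"
    using assms unfolding adjacent_def by blast+
  then obtain i0 where i0: "{i. i < length D \<and> D ! i \<noteq> D' ! i} = {i0}"
    by (meson card_1_singletonE)
  have "D ! i = D' ! i" if "i < length D" "i \<noteq> i0" for i
    using i0 that by blast
  then have "?S D \<subseteq> insert i0 (?S D')" using len by force
  then have "card (?S D) \<le> card (insert i0 (?S D'))" by (intro card_mono) simp_all
  also have "\<dots> \<le> Suc (card (?S D'))" by (simp add: card_insert_if)
  finally show ?thesis unfolding violation_count_def .
qed

lemma adjacent_sym:
  assumes "adjacent D D'"
  shows "adjacent D' D"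
proof -
  have len: "length D = length D'" and c: "card {i. i < length D \<and> D ! i \<noteq> D' ! i} = 1"
    using assms unfolding adjacent_def by blast+
  have "{i. i < length D' \<and> D' ! i \<noteq> D ! i} = {i. i < length D \<and> D ! i \<noteq> D' ! i}"
    unfolding len by metis
  then show ?thesis unfolding adjacent_def using len c by simp
qed

lemma differentially_private_noisy_counts:
  assumes "n + 2 ^ w \<le> 2 ^ g * 2 ^ w" and "real (length L) * (2 ^ (g + h) / 2 ^ w) \<le> \<epsilon>"
  shows "differentially_private \<epsilon> n d (\<lambda>D. noisy_counts w g h (map (violation_count D) L))"
proof -
  let ?A = "\<lambda>D. noisy_counts w g h (map (violation_count D) L)"
  have "pmf (?A D) ys \<le> exp \<epsilon> * pmf (?A D') ys"
    if D: "D \<in> databases n d" "D' \<in> databases n d" "adjacent D D'" for D D' ys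
  proof -
    have "violation_count D \<tau> \<le> n \<and> violation_count D' \<tau> \<le> n \<and>
        violation_count D \<tau> \<le> Suc (violation_count D' \<tau>) \<and> violation_count D' \<tau> \<le> Suc (violation_count D \<tau>)" for \<tau>
    proof -
      have "length D = n" "length D' = n" using D by (auto simp: databases_def)
      then show ?thesis
        using violation_count_le[of D \<tau>] violation_count_le[of D' \<tau>]
          violation_count_adjacent[OF D(3), of \<tau>] violation_count_adjacent[OF adjacent_sym[OF D(3)], of \<tau>]
        by simp
    qed
    then have "list_all2 (\<lambda>c c'. c \<le> n \<and> c' \<le> n \<and> c \<le> Suc c' \<and> c' \<le> Suc c)
        (map (violation_count D) L) (map (violation_count D') L)"
      by (simp only: list_all2_map1 list_all2_map2 list_all2_same) blast
    from pmf_noisy_counts_le[OF this assms(1)]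
    have "pmf (?A D) ys \<le> exp (real (length L) * (2 ^ (g + h) / 2 ^ w)) * pmf (?A D') ys"
      by (simp only: length_map)
    also have "\<dots> \<le> exp \<epsilon> * pmf (?A D') ys"
      using assms(2) by (intro mult_right_mono) (simp_all only: exp_le_cancel_iff pmf_nonneg)
    finally show ?thesis .
  qed
  then have "measure_pmf.prob (?A D) S \<le> exp \<epsilon> * measure_pmf.prob (?A D') S"
    if "D \<in> databases n d" "D' \<in> databases n d" "adjacent D D'" for D D' S
    using that by (intro prob_le_of_pmf_le[of "?A D" "exp \<epsilon>" "?A D'" S] exp_ge_zero) blast+
  then show ?thesis by (simp only: differentially_private_def) blast
qed

subsection \<open>Choice of the parameters\<close>

lemma power_of_two_below:
  fixes x :: real
  assumes "1 \<le> x"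
  obtains m where "2 ^ m \<le> x" "x < 2 * 2 ^ m"
proof -
  have ex: "\<exists>m. x < 2 ^ m" using real_arch_pow[of 2 x] by simp
  define m where "m = (LEAST m. x < 2 ^ m)"
  have m: "x < 2 ^ m" unfolding m_def by (rule LeastI_ex[OF ex])
  then have "m \<noteq> 0" using assms by (intro notI) simp
  then obtain m' where m': "m = Suc m'" by (cases m) auto
  then have "\<not> x < 2 ^ m'" using not_less_Least[of m' "\<lambda>m. x < 2 ^ m"] by (simp add: m_def)
  then show thesis using m m' that[of m'] by simp
qed

text \<open>\<open>2^w\<close> is about \<open>n / X\<close>, as large as accuracy permits because
  coarser rounding means more privacy; \<open>2^h \<ge> 10 N\<close> brings the union bound down to
  1/10.\<close>

lemma noise_parameters:
  fixes X N :: real and n :: nat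
  assumes "1 \<le> X" "1 \<le> N" "1 \<le> n"
  obtains w g h where
    "X * (2 ^ w - 1) \<le> real n" "real n \<le> 2 * X * 2 ^ w" "2 ^ w \<le> n"
    "n + 2 ^ w \<le> 2 ^ g * 2 ^ w" "2 ^ g \<le> 6 * X" "10 * N \<le> 2 ^ h" "2 ^ h \<le> 20 * N"
proof -
  obtain w where w: "X * (2 ^ w - 1) \<le> real n" "real n \<le> 2 * X * 2 ^ w" "2 ^ w \<le> n"
  \<comment> \<open>If \<open>X > n\<close>, the choice \<open>w = 0\<close> rounds exactly.\<close>
  proof (cases "X \<le> real n")
    case True
    then have "1 \<le> real n / X" using assms by simp
    from power_of_two_below[OF this] obtain w where w: "2 ^ w \<le> real n / X" "real n / X < 2 * 2 ^ w" .
    then have 1: "X * 2 ^ w \<le> real n" "real n < X * (2 * 2 ^ w)"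
      using assms by (simp_all add: field_simps)
    have "1 * 2 ^ w \<le> X * 2 ^ w" using assms by (intro mult_right_mono) auto
    then have "real (2 ^ w) \<le> real n" using 1(1) unfolding of_nat_power of_nat_numeral by linarith
    then have "2 ^ w \<le> n" by (simp only: of_nat_le_iff)
    moreover have "X * (2 ^ w - 1) \<le> real n" using 1 assms by (simp add: right_diff_distrib)
    ultimately show thesis using 1 by (intro that[of w]) (auto simp: mult_ac)
  next
    case False
    then show thesis using assms by (intro that[of 0]) auto
  qed
  \<comment> \<open>The grid needs at least \<open>n / 2^w + 1\<close> points, for which
    \<open>2 X + 1\<close> suffice. Raising \<open>g\<close> and \<open>h\<close> by one below makes
    the powers large enough, and \<open>2 (2 X + 1) \<le> 6 X\<close>.\<close>
  have "1 \<le> 2 * X + 1" using assms by simp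
  from power_of_two_below[OF this] obtain g where g: "2 ^ g \<le> 2 * X + 1" "2 * X + 1 < 2 * 2 ^ g" .
  have "1 \<le> 10 * N" using assms by simp
  from power_of_two_below[OF this] obtain h where h: "2 ^ h \<le> 10 * N" "10 * N < 2 * 2 ^ h" .
  have "real (n + 2 ^ w) \<le> (2 * X + 1) * 2 ^ w" using w by (simp add: algebra_simps)
  also have "\<dots> \<le> 2 ^ Suc g * 2 ^ w" using g by (intro mult_right_mono) auto
  also have "\<dots> = real (2 ^ Suc g * 2 ^ w)" by simp
  finally have "n + 2 ^ w \<le> 2 ^ Suc g * 2 ^ w" by (simp only: of_nat_le_iff)
  then show thesis using w g h assms by (intro that[of w "Suc g" "Suc h"]) auto
qed

text \<open>Up to constants and a factor linear in \<open>t\<close>, every summand is at most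
  \<open>Y = n N^2 X\<close>. This gives \<open>K^23\<close>; the exponent 30 is the one that
  privacy dictates.\<close>

lemma cost_bound:
  fixes X N K :: real and n t w g h M :: nat
  assumes X: "1 \<le> X" "X \<le> K ^ 8" and N: "1 \<le> N" "N \<le> K ^ 3" and M: "real M \<le> X" and n: "1 \<le> n"
    and K: "2 \<le> K" "real t + 1 \<le> K"
    and w: "2 ^ w \<le> n" and g: "2 ^ g \<le> 6 * X" and h: "2 ^ h \<le> 20 * N"
  shows "9 + real n + 2 ^ w + 2 ^ g + N * (real n * (3 + 6 * real t) + 4 * (real w + real g + real h) + 16) +
      (16 + N * (9 + 9 * real t + 2 ^ w * real M)) \<le> real n * K ^ 30"
proof -
  have e: "real m \<le> 2 ^ m" for m :: nat
    using less_exp[of m] by (metis less_imp_le of_nat_le_iff of_nat_numeral of_nat_power)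
  have wn: "(2::real) ^ w \<le> real n" using w by (metis of_nat_le_iff of_nat_numeral of_nat_power)
  have n1: "1 \<le> real n" using n by simp
  define Y where "Y = real n * (N ^ 2 * X)"
  have NX: "1 \<le> N * X" "1 \<le> N ^ 2 * X" "N \<le> N ^ 2 * X" "X \<le> N ^ 2 * X" "N * X \<le> N ^ 2 * X" "N ^ 2 \<le> N ^ 2 * X"
  proof -
    have N2: "N \<le> N ^ 2" using N by (simp add: power2_eq_square)
    have "1 * 1 \<le> N * X" using X N by (intro mult_mono) auto
    then show 1: "1 \<le> N * X" by simp
    show "N * X \<le> N ^ 2 * X" using N2 X by (intro mult_right_mono) auto
    then show "1 \<le> N ^ 2 * X" using 1 by simp
    have "N ^ 2 * 1 \<le> N ^ 2 * X" using X by (intro mult_left_mono) auto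
    then show "N ^ 2 \<le> N ^ 2 * X" "N \<le> N ^ 2 * X" using N2 by auto
    have "1 * X \<le> N ^ 2 * X" using N N2 X by (intro mult_right_mono) auto
    then show "X \<le> N ^ 2 * X" by simp
  qed
  have up: "a \<le> Y" if "0 \<le> a" "a \<le> N ^ 2 * X" for a
  proof -
    have "1 * (N ^ 2 * X) \<le> Y" unfolding Y_def using n1 NX by (intro mult_right_mono) auto
    then show ?thesis using that by simp
  qed
  have upn: "real n * a \<le> Y" if "a \<le> N ^ 2 * X" for a
    unfolding Y_def using that by (intro mult_left_mono) auto
  have b1: "1 \<le> Y" "real n \<le> Y" "X \<le> Y" "N \<le> Y"
    using up[of 1] upn[of 1] up[of X] up[of N] NX X N by auto
  have b2: "real n * N \<le> Y" using upn NX by blast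
  have t0: "0 \<le> real t" by simp
  have "N * (real n * (3 + 6 * real t)) = real n * N * (3 + 6 * real t)" by simp
  also have "\<dots> \<le> Y * (3 + 6 * real t)" using b2 t0 by (intro mult_right_mono) auto
  finally have c1: "N * (real n * (3 + 6 * real t)) \<le> Y * (3 + 6 * real t)" .
  have "real w \<le> real n" using e[of w] wn by (rule order_trans)
  then have "N * real w \<le> N * real n" using N by (intro mult_left_mono) simp_all
  then have c2: "N * real w \<le> Y" using b2 by (simp add: mult.commute)
  have "N * real g \<le> N * (6 * X)" using order_trans[OF e g] N by (intro mult_left_mono) simp_all
  then have c3: "N * real g \<le> 6 * Y" using up[of "N * X"] NX by simp
  have "N * real h \<le> N * (20 * N)" using order_trans[OF e h] N by (intro mult_left_mono) simp_all
  then have c4: "N * real h \<le> 20 * Y" using up[of "N ^ 2"] NX by (simp add: power2_eq_square)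
  have "N * (9 * real t) \<le> Y * (9 * real t)" using b1 t0 by (intro mult_right_mono) auto
  then have c5: "N * (9 * real t) \<le> Y * (9 * real t)" .
  have "2 ^ w * real M \<le> real n * X" using wn M by (intro mult_mono) auto
  then have "N * (2 ^ w * real M) \<le> N * (real n * X)" using N by (intro mult_left_mono) auto
  also have "\<dots> = real n * (N * X)" by simp
  also have "\<dots> \<le> Y" using NX by (intro upn)
  finally have c6: "N * (2 ^ w * real M) \<le> Y" .
  have "9 + real n + 2 ^ w + 2 ^ g + N * (real n * (3 + 6 * real t) + 4 * (real w + real g + real h) + 16) +
      (16 + N * (9 + 9 * real t + 2 ^ w * real M)) =
      25 + real n + 2 ^ w + 2 ^ g + N * (real n * (3 + 6 * real t)) + 4 * (N * real w) + 4 * (N * real g)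
      + 4 * (N * real h) + 25 * N + N * (9 * real t) + N * (2 ^ w * real M)"
    by (simp add: algebra_simps)
  also have "\<dots> \<le> 25 * Y + Y + Y + 6 * Y + Y * (3 + 6 * real t) + 4 * Y + 24 * Y + 80 * Y + 25 * Y + Y * (9 * real t) + Y"
    using b1 c1 c2 c3 c4 c5 c6 wn g by linarith
  also have "\<dots> = Y * (170 + 15 * real t)" by (simp add: algebra_simps)
  also have "\<dots> \<le> Y * (K ^ 8 * K)"
  proof (intro mult_left_mono)
    have "2 ^ 8 \<le> K ^ 8" using K by (intro power_mono) auto
    then have "256 * (real t + 1) \<le> K ^ 8 * K" using K by (intro mult_mono) auto
    then show "170 + 15 * real t \<le> K ^ 8 * K" by (simp add: algebra_simps)
  qed (use b1 in auto)
  also have "\<dots> \<le> real n * ((K ^ 3) ^ 2 * K ^ 8) * (K ^ 8 * K)"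
    unfolding Y_def using N X K by (intro mult_mono power_mono mult_nonneg_nonneg) auto
  also have "\<dots> = real n * K ^ 23" by (simp add: power_mult[symmetric] power_add[symmetric] flip: power_Suc2)
  also have "\<dots> \<le> real n * K ^ 30" using K by (intro mult_left_mono power_increasing) auto
  finally show ?thesis .
qed

text \<open>The loss is at most \<open>240 N^2 X^2 / n\<close>, where 240 = 6 * 20 * 2. With
  \<open>240 \<le> K^8\<close> the exponents add up to 8 + 6 + 16 = 30.\<close>

lemma privacy_bound:
  fixes X N K \<epsilon> :: real and n w g h :: nat
  assumes X: "1 \<le> X" "X \<le> K ^ 8" and N: "1 \<le> N" "N \<le> K ^ 3" and K: "2 \<le> K" and n: "1 \<le> n"
    and \<epsilon>: "0 < \<epsilon>" "K ^ 30 / \<epsilon> \<le> real n"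
    and w: "real n \<le> 2 * X * 2 ^ w" and g: "2 ^ g \<le> 6 * X" and h: "2 ^ h \<le> 20 * N"
  shows "N * (2 ^ (g + h) / 2 ^ w) \<le> \<epsilon>"
proof -
  have "N * 2 ^ (g + h) \<le> N * ((6 * X) * (20 * N))"
    unfolding power_add using X N g h by (intro mult_mono) auto
  then have "N * 2 ^ (g + h) * real n \<le> N * ((6 * X) * (20 * N)) * (2 * X * 2 ^ w)"
    using w X N by (intro mult_mono) auto
  also have "\<dots> = 240 * (N ^ 2 * X ^ 2) * 2 ^ w" by (simp add: power2_eq_square)
  also have "\<dots> \<le> K ^ 8 * ((K ^ 3) ^ 2 * (K ^ 8) ^ 2) * 2 ^ w"
  proof (intro mult_right_mono mult_mono power_mono)
    have "2 ^ 8 \<le> K ^ 8" using K by (intro power_mono) auto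
    then show "240 \<le> K ^ 8" by simp
  qed (use X N K in auto)
  also have "\<dots> = K ^ 30 * 2 ^ w" by (simp add: power_mult[symmetric] power_add[symmetric])
  also have "\<dots> \<le> \<epsilon> * real n * 2 ^ w"
    using \<epsilon> by (intro mult_right_mono) (auto simp: field_simps)
  finally have "N * 2 ^ (g + h) * real n \<le> (\<epsilon> * 2 ^ w) * real n" by (simp add: mult_ac)
  then have "N * 2 ^ (g + h) \<le> \<epsilon> * 2 ^ w" using n by simp
  then show ?thesis by (simp add: pos_divide_le_eq)
qed

lemma private_release_exists:
  fixes \<alpha> \<epsilon> :: real
  assumes k: "1 \<le> k" "k \<le> d" and d: "2 \<le> d" and n: "1 \<le> n" and \<alpha>: "0 < \<alpha>" "\<alpha> \<le> 1"
    and r: "1 \<le> r" "k \<le> r ^ 2" and j: "2 / \<alpha> \<le> 2 ^ j"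
    and \<epsilon>: "0 < \<epsilon>" "real d ^ (30 * (j * r)) / \<epsilon> \<le> real n"
  shows "\<exists>A E tA tE. differentially_private \<epsilon> n d A \<and> sanitizer_in_time n d tA A \<and>
    evaluator_in_time d k tE E \<and> real (tA + tE) \<le> real n * real d ^ (30 * (j * r)) \<and>
    (\<forall>D\<in>databases n d.
      measure_pmf.prob (A D) {z. \<forall>q\<in>marginals d k. \<bar>E z q - query_value q D\<bar> \<le> \<alpha>} \<ge> 9 / 10)"
proof -
  define t where "t = j * r"
  define L where "L = tuples d t"
  define N where "N = real (length L)"
  define M where "M = (7 * k) ^ t"
  define X where "X = 2 * N * real M / \<alpha>"
  define K where "K = real d ^ t"
  \<comment> \<open>Both normalisations, by the number of rows and by the value at 0, are part of
    the fixed denominator.\<close>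
  define s where "s = n * nat (cheb k t 0)"
  have "j \<noteq> 0" using j \<alpha> by (intro notI) (simp add: field_simps)
  then have t1: "1 \<le> t" using r by (simp add: t_def)
  have d1: "1 \<le> d" using d by simp
  have "[] \<in> set L" by (auto simp: L_def tuples_def intro!: bexI[of _ 0] simp del: upt_Suc)
  then have "1 \<le> length L" by (cases L) auto
  then have N1: "1 \<le> N" unfolding N_def by (metis of_nat_1 of_nat_le_iff)
  have K_pow: "real a ^ t \<le> K ^ m" if "a \<le> d ^ m" for a m
  proof -
    have "real a ^ t \<le> (real d ^ m) ^ t"
      using that by (intro power_mono) (simp_all flip: of_nat_power)
    then show ?thesis by (simp add: K_def mult.commute flip: power_mult)
  qed
  \<comment> \<open>Here \<open>d \<ge> 2\<close> turns constants into powers of \<open>d\<close>: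
    \<open>4 \<le> d^2\<close> and \<open>7 \<le> d^3\<close>.\<close>
  have d4: "4 * d \<le> d ^ 3" "7 * k \<le> d ^ 4"
  proof -
    have p: "2 ^ i \<le> d ^ i" for i using d by (intro power_mono) auto
    have "4 * d \<le> d ^ 2 * d" using p[of 2] by (intro mult_right_mono) auto
    then show "4 * d \<le> d ^ 3" by (simp add: power3_eq_cube power2_eq_square)
    have "7 * k \<le> d ^ 3 * d" using p[of 3] k by (intro mult_mono) auto
    then show "7 * k \<le> d ^ 4" by (simp flip: power_Suc2)
  qed
  have K2: "2 \<le> K"
  proof -
    have "2 ^ 1 \<le> real d ^ 1" using d by simp
    also have "\<dots> \<le> K" unfolding K_def using d t1 by (intro power_increasing) auto
    finally show ?thesis by simp
  qed
  have "real (length L) \<le> real ((4 * d) ^ t)" unfolding L_def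
    using length_tuples_le[OF d1] by (simp only: of_nat_le_iff)
  then have NK: "N \<le> K ^ 3" using K_pow[OF d4(1)] by (simp add: N_def)
  have MK: "real M \<le> K ^ 4" using K_pow[OF d4(2)] by (simp add: M_def)
  have "1 \<le> M" unfolding M_def using k by (intro one_le_power) simp
  then have M1: "1 \<le> real M" by simp
  have two_t: "2 ^ t \<le> K" unfolding K_def using d by (intro power_mono) auto
  have "2 / \<alpha> \<le> 2 ^ t" using r by (intro order_trans[OF j] power_increasing) (auto simp: t_def)
  then have aK: "2 / \<alpha> \<le> K" using two_t by simp
  have tK: "real t + 1 \<le> K"
  proof -
    have "Suc t \<le> 2 ^ t" by (intro Suc_leI less_exp)
    then have "real (Suc t) \<le> real (2 ^ t)" by (simp only: of_nat_le_iff)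
    then show ?thesis using two_t by simp
  qed
  have X: "real M \<le> X" "X \<le> K ^ 8"
  proof -
    have e: "X = N * real M * (2 / \<alpha>)" by (simp add: X_def)
    have "1 * real M * 1 \<le> X" unfolding e using N1 M1 \<alpha> by (intro mult_mono) auto
    then show "real M \<le> X" by simp
    have "X \<le> K ^ 3 * K ^ 4 * K" unfolding e using NK MK aK N1 M1 \<alpha> K2 by (intro mult_mono) auto
    also have "\<dots> = K ^ 8" by (simp flip: power_add power_Suc2)
    finally show "X \<le> K ^ 8" .
  qed
  have X1: "1 \<le> X" using X M1 by simp
  obtain w g h where w: "X * (2 ^ w - 1) \<le> real n" "real n \<le> 2 * X * 2 ^ w" "2 ^ w \<le> n"
    and g: "n + 2 ^ w \<le> 2 ^ g * 2 ^ w" "2 ^ g \<le> 6 * X" and h: "10 * N \<le> 2 ^ h" "2 ^ h \<le> 20 * N"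
    using noise_parameters[OF X1 N1 n] by metis
  have KB: "K ^ 30 = real d ^ (30 * (j * r))" by (simp add: K_def t_def mult.commute flip: power_mult)
  have A0: "2 / \<alpha> * real k ^ t \<le> real_of_int (cheb k t 0)"
  proof -
    have "2 / \<alpha> * real k ^ t \<le> 2 ^ j * real k ^ t" using j by (intro mult_right_mono) auto
    also have "\<dots> = real_of_int (int k ^ (j * r) * 2 ^ j)" by (simp add: t_def)
    also have "\<dots> \<le> real_of_int (cheb k t 0)"
      unfolding t_def by (simp only: of_int_le_iff) (rule cheb_0_ge[OF k(1) r(2)])
    finally show ?thesis .
  qed
  moreover have "0 < 2 / \<alpha> * real k ^ t" using \<alpha> k by simp
  ultimately have "0 < cheb k t 0" by linarith
  then have s0: "0 < s" using n by (simp add: s_def)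
  let ?a = "term_weight w k t"
  let ?A = "\<lambda>D. noisy_counts w g h (map (violation_count D) L)"
  let ?E = "\<lambda>z q. real_of_int (evaluator_sum ?a L z q) / real s"
  let ?PA = "sanitizer_code d n w g h L" and ?PE = "evaluator_code d ?a L"
  have Ld: "\<forall>\<tau>\<in>set L. \<forall>l\<in>set \<tau>. fst l < d" and Lt: "\<forall>\<tau>\<in>set L. length \<tau> \<le> t"
    using tuples_bounds unfolding L_def by blast+
  have dp: "differentially_private \<epsilon> n d ?A"
    using privacy_bound[OF X1 X(2) N1 NK K2 n \<epsilon>(1) _ w(2) g(2) h(2)] \<epsilon>(2) KB
    by (intro differentially_private_noisy_counts g) (simp add: N_def)
  have sa: "sanitizer_in_time n d (length ?PA) ?A"
    by (intro sanitizer_straight_line jump_free_sanitizer_code run_sanitizer_code[symmetric] Ld)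
  have ev: "evaluator_in_time d k (length ?PE) ?E"
  proof (rule evaluator_straight_line[of ?PE s d k ?E, OF _ _ s0])
    show "list_all jump_free ?PE" using evaluator_code_instrs[of d ?a L] by (simp add: list_all_iff)
    show "coin_free ?PE" using evaluator_code_instrs[of d ?a L] by (auto simp: coin_free_def list_all_iff)
    fix z q assume "q \<in> marginals d k"
    obtain m y where "run (encode_query d q @ z) ?PE (\<lambda>_. 0, []) = return_pmf (m, y)" "m 0 = evaluator_sum ?a L z q"
      using run_evaluator_code[OF Ld] by blast
    then show "\<exists>m y. run (encode_query d q @ z) ?PE (\<lambda>_. 0, []) = return_pmf (m, y) \<and>
        ?E z q = real_of_int (m 0) / real s" by auto
  qed
  have la: "length ?PA \<le> 9 + n + 2 ^ w + 2 ^ g + length L * (n * (3 + 6 * t) + 4 * (w + g + h) + 16)"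
    by (rule length_sanitizer_code[OF Lt])
  have wt: "nat \<bar>?a \<tau>\<bar> \<le> 2 ^ w * M" for \<tau>
  proof -
    have "\<bar>?a \<tau>\<bar> \<le> 2 ^ w * (7 * int k) ^ t"
      using abs_cheb_coeff_le[OF k(1)] by (simp add: term_weight_def abs_mult)
    also have "\<dots> = int (2 ^ w * M)" by (simp add: M_def)
    finally show ?thesis by linarith
  qed
  have le: "length ?PE \<le> 16 + length L * (9 + 9 * t + 2 ^ w * M)"
    using Lt wt by (intro length_evaluator_code) auto
  have "real (length ?PA) \<le> 9 + real n + 2 ^ w + 2 ^ g + N * (real n * (3 + 6 * real t) + 4 * (real w + real g + real h) + 16)"
    using of_nat_mono[OF la, where ?'a = real] by (simp add: N_def)
  moreover have "real (length ?PE) \<le> 16 + N * (9 + 9 * real t + 2 ^ w * real M)"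
    using of_nat_mono[OF le, where ?'a = real] by (simp add: N_def)
  ultimately have time: "real (length ?PA + length ?PE) \<le> real n * real d ^ (30 * (j * r))"
    using cost_bound[OF X1 X(2) N1 NK X(1) n K2 tK w(3) g(2) h(2)] unfolding KB by simp
  have acc: "measure_pmf.prob (?A D) {z. \<forall>q\<in>marginals d k. \<bar>?E z q - query_value q D\<bar> \<le> \<alpha>} \<ge> 9 / 10"
    if D: "D \<in> databases n d" for D
  proof -
    let ?Q = "\<lambda>z. list_all2 (\<lambda>c y. \<exists>u<2^w. y = int ((c + u) div 2 ^ w)) (map (violation_count D) L) z"
    have Dn: "length D = n" using D by (simp add: databases_def)
    have ww: "2 * real (length (tuples d t)) * (7 * real k) ^ t * (2 ^ w - 1) \<le> \<alpha> * real n"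
    proof -
      have "\<alpha> * (X * (2 ^ w - 1)) \<le> \<alpha> * real n" using w(1) \<alpha> by (intro mult_left_mono) auto
      then show ?thesis using \<alpha> by (simp add: X_def N_def M_def L_def)
    qed
    have "{z. ?Q z} \<subseteq> {z. \<forall>q\<in>marginals d k. \<bar>?E z q - query_value q D\<bar> \<le> \<alpha>}"
      using evaluator_sum_accurate[OF _ k(1) \<alpha>(1) Dn n A0 ww] unfolding s_def L_def by blast
    then have "measure_pmf.prob (?A D) {z. ?Q z} \<le>
        measure_pmf.prob (?A D) {z. \<forall>q\<in>marginals d k. \<bar>?E z q - query_value q D\<bar> \<le> \<alpha>}"
      by (intro measure_pmf.finite_measure_mono) auto
    moreover have "measure_pmf.prob (?A D) {z. ?Q z} = 1 - measure_pmf.prob (?A D) {z. \<not> ?Q z}"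
      using measure_pmf.prob_compl[of "{z. \<not> ?Q z}" "?A D"] by (simp add: Compl_eq_Diff_UNIV[symmetric] Collect_neg_eq[symmetric])
    moreover have "measure_pmf.prob (?A D) {z. \<not> ?Q z} \<le> N / 2 ^ h"
      using prob_noisy_counts_inaccurate[of w g h "map (violation_count D) L"] by (simp only: N_def length_map)
    moreover have "N / 2 ^ h \<le> 1 / 10" using h by (simp add: field_simps)
    ultimately show ?thesis by linarith
  qed
  show ?thesis using dp sa ev time acc by blast
qed

section \<open>Degenerate parameters and choice of the degree\<close>

lemma differentially_private_const:
  assumes "0 < \<epsilon>"
  shows "differentially_private \<epsilon> n d (\<lambda>_. return_pmf z)"
proof -
  have "p \<le> exp \<epsilon> * p" if "0 \<le> p" for p :: real
    using mult_right_mono[of 1 "exp \<epsilon>" p] assms that by simp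
  then show ?thesis by (simp only: differentially_private_def measure_nonneg) blast
qed

text \<open>For \<open>n = 0\<close> the time budget is 0, so the programs must be empty.\<close>

lemma empty_sanitizer: "sanitizer_in_time n d 0 (\<lambda>_. return_pmf [])"
  using sanitizer_straight_line[of "[]" n d "\<lambda>_. return_pmf []"] by simp

lemma empty_evaluator: "evaluator_in_time d k 0 (\<lambda>z q. 0)"
  using evaluator_straight_line[of "[]" 1 d k "\<lambda>z q. 0"] by (simp add: coin_free_def)

text \<open>If \<alpha> is 1 or \<open>k\<close> is 0, the whole budget is \<open>n\<close> and
  leaves no room for tables; the denominator still permits the answers 1/2 and 1.\<close>

lemma constant_evaluator:
  assumes "0 < s"
  shows "evaluator_in_time d k 1 (\<lambda>z q. 1 / real s)"
  using evaluator_straight_line[of "[Const 0 1]" s d k "\<lambda>z q. 1 / real s"] assms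
  by (simp add: coin_free_def bind_return_pmf)

lemma query_value_bounds: "0 \<le> query_value q D" "query_value q D \<le> 1"
proof -
  have "card {i. i < length D \<and> (\<forall>j\<in>dom q. D ! i ! j = the (q j))} \<le> card {..<length D}"
    by (intro card_mono) auto
  then show "query_value q D \<le> 1" by (auto simp: query_value_def divide_le_eq_1)
qed (simp add: query_value_def)

lemma query_value_no_attributes:
  assumes "q \<in> marginals d 0" "D \<noteq> []"
  shows "query_value q D = 1"
proof -
  have "dom q = {}" using assms by (auto simp: marginals_def finite_subset[of _ "{..<d}"])
  then show ?thesis using assms by (simp add: query_value_def)
qed

text \<open>Rounding \<open>sqrt k\<close> up at most doubles it. Since \<alpha> is below 1/2,
  \<open>ln 2 \<le> ln (1 / \<alpha>)\<close> absorbs the additive constants in \<open>j\<close>,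
  leaving a factor 3, which becomes 9/2 as \<open>ln 2 \<ge> 2/3\<close>.\<close>

lemma degree_bound:
  fixes \<alpha> :: real
  assumes k: "1 \<le> k" and \<alpha>: "0 < \<alpha>" "\<alpha> < 1 / 2"
  obtains j r where "1 \<le> r" "k \<le> r ^ 2" "2 / \<alpha> \<le> 2 ^ j" "real (j * r) \<le> 9 * sqrt (real k) * ln (1 / \<alpha>)"
proof -
  define r where "r = nat \<lceil>sqrt (real k)\<rceil>"
  have sk: "1 \<le> sqrt (real k)" using k by simp
  have r: "sqrt (real k) \<le> real r" "real r \<le> sqrt (real k) + 1" unfolding r_def using sk by linarith+
  have "real k = sqrt (real k) ^ 2" by simp
  also have "\<dots> \<le> real r ^ 2" using r by (intro power_mono) auto
  finally have "real k \<le> real (r ^ 2)" by simp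
  then have kr: "k \<le> r ^ 2" by (simp only: of_nat_le_iff)
  have "1 \<le> 2 / \<alpha>" using \<alpha> by simp
  from power_of_two_below[OF this] obtain j where j: "2 ^ j \<le> 2 / \<alpha>" "2 / \<alpha> < 2 * 2 ^ j" .
  have l2: "2 / 3 \<le> ln (2::real)" by (rule ln2_ge_two_thirds)
  have "ln 2 \<le> ln (1 / \<alpha>)" using \<alpha> by (subst ln_le_cancel_iff) (auto simp: field_simps)
  moreover have "real j * ln 2 \<le> ln 2 + ln (1 / \<alpha>)"
  proof -
    have "ln (2 ^ j) \<le> ln (2 * (1 / \<alpha>))" using j \<alpha> by (subst ln_le_cancel_iff) auto
    then show ?thesis using \<alpha> by (simp add: ln_realpow ln_mult ln_div)
  qed
  ultimately have "real (Suc j) * ln 2 \<le> 3 * ln (1 / \<alpha>)" by (simp add: algebra_simps)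
  moreover have "real (Suc j) * (2 / 3) \<le> real (Suc j) * ln 2" using l2 by (intro mult_left_mono) auto
  ultimately have "real (Suc j) * (2 / 3) \<le> 3 * ln (1 / \<alpha>)" by (rule order_trans[rotated])
  from mult_right_mono[OF this, of "3 / 2"]
  have jl: "real (Suc j) \<le> 9 / 2 * ln (1 / \<alpha>)" by (simp del: of_nat_Suc)
  have "real r \<le> 2 * sqrt (real k)" using r(2) sk by linarith
  then have "real (Suc j) * real r \<le> (9 / 2 * ln (1 / \<alpha>)) * (2 * sqrt (real k))"
    using jl by (intro mult_mono) simp_all
  then have "real (Suc j * r) \<le> 9 * sqrt (real k) * ln (1 / \<alpha>)" by (simp add: algebra_simps)
  moreover have "1 \<le> r" using r sk by linarith
  ultimately show thesis using kr j by (intro that[of r "Suc j"]) auto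
qed

theorem theorem1:
  "\<exists>C::real. \<forall>(k::nat) (d::nat) (n::nat) (\<alpha>::real) (\<epsilon>::real).
     2 \<le> d \<and> k \<le> d \<and> 0 < \<alpha> \<and> \<alpha> \<le> 1 \<and> 0 < \<epsilon> \<longrightarrow>
     (\<exists>(A :: database \<Rightarrow> int list pmf) (E :: int list \<Rightarrow> marginal_query \<Rightarrow> real)
        (tA::nat) (tE::nat).
        differentially_private \<epsilon> n d A \<and>
        sanitizer_in_time n d tA A \<and>
        evaluator_in_time d k tE E \<and>
        real (tA + tE) \<le> real n * real d powr (C * sqrt (real k) * ln (1 / \<alpha>)) \<and>
        (\<forall>D\<in>databases n d.
           real (length D) \<ge> real d powr (C * sqrt (real k) * ln (1 / \<alpha>)) / \<epsilon> \<longrightarrow>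
           measure_pmf.prob (A D)
             {z. \<forall>q\<in>marginals d k. \<bar>E z q - query_value q D\<bar> \<le> \<alpha>} \<ge> 9 / 10))"
proof (intro exI[of _ 270] allI impI, elim conjE)
  fix k d n :: nat and \<alpha> \<epsilon> :: real
  assume d: "2 \<le> d" and kd: "k \<le> d" and \<alpha>: "0 < \<alpha>" "\<alpha> \<le> 1" and \<epsilon>: "0 < \<epsilon>"
  \<comment> \<open>270 = 30 * 9: the exponent of \<open>K\<close> from the privacy bound times the
    constant of the degree bound.\<close>
  define B where "B = real d powr (270 * sqrt (real k) * ln (1 / \<alpha>))"
  let ?goal = "\<lambda>A E tA tE.
      differentially_private \<epsilon> n d A \<and> sanitizer_in_time n d tA A \<and> evaluator_in_time d k tE E \<and>
      real (tA + tE) \<le> real n * B \<and>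
      (\<forall>D\<in>databases n d. real (length D) \<ge> B / \<epsilon> \<longrightarrow>
         measure_pmf.prob (A D) {z. \<forall>q\<in>marginals d k. \<bar>E z q - query_value q D\<bar> \<le> \<alpha>} \<ge> 9 / 10)"
  have "0 \<le> ln (1 / \<alpha>)" using \<alpha> by simp
  then have B1: "1 \<le> B" unfolding B_def using d by (intro ge_one_powr_ge_zero) auto
  have Bpos: "0 < B / \<epsilon>" using B1 \<epsilon> by simp
  have const: "\<exists>A E tA tE. ?goal A E tA tE"
    if "0 < s" "1 \<le> n" "\<And>D q. D \<in> databases n d \<Longrightarrow> q \<in> marginals d k \<Longrightarrow> \<bar>1 / real s - query_value q D\<bar> \<le> \<alpha>" for s
  proof (intro exI conjI ballI impI)
    show "real (0 + 1) \<le> real n * B"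
      using mult_mono[of 1 "real n" 1 B] that(2) B1 by simp
    fix D assume "D \<in> databases n d"
    then have "{z :: int list. \<forall>q\<in>marginals d k. \<bar>1 / real s - query_value q D\<bar> \<le> \<alpha>} = UNIV"
      using that(3) by auto
    then show "9 / 10 \<le> measure_pmf.prob (return_pmf []) {z :: int list. \<forall>q\<in>marginals d k. \<bar>1 / real s - query_value q D\<bar> \<le> \<alpha>}"
      by (simp only:) simp
  qed (use \<epsilon> that empty_sanitizer constant_evaluator differentially_private_const in auto)
  have "\<exists>A E tA tE. ?goal A E tA tE"
  proof (cases "real n < B / \<epsilon>")
    \<comment> \<open>Accuracy is not promised here, so releasing nothing is admissible; this covers
      \<open>n = 0\<close>.\<close>
    case True
    then have "?goal (\<lambda>_. return_pmf []) (\<lambda>z q. 0) 0 0"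
      using \<epsilon> B1 by (auto simp: empty_sanitizer empty_evaluator differentially_private_const databases_def)
    then show ?thesis by blast
  next
    case False
    then have n: "1 \<le> n" using Bpos by (cases n) auto
    \<comment> \<open>In the first two cases the exponent may vanish while constants remain; a
      constant answer is accurate enough there.\<close>
    consider "1 / 2 \<le> \<alpha>" | "k = 0" | "\<alpha> < 1 / 2" "1 \<le> k" by linarith
    then show ?thesis
    proof cases
      case 1
      have "\<bar>1 / real 2 - query_value q D\<bar> \<le> \<alpha>" for q D
        using 1 query_value_bounds[of q D] by auto
      then show ?thesis using n by (intro const[of 2]) auto
    next
      case 2
      have "\<bar>1 / real 1 - query_value q D\<bar> \<le> \<alpha>" if "D \<in> databases n d" "q \<in> marginals d k" for q D
      proof -
        have "D \<noteq> []" using that n by (auto simp: databases_def)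
        then show ?thesis using 2 that \<alpha> query_value_no_attributes[of q d D] by simp
      qed
      then show ?thesis using n by (intro const[of 1]) auto
    next
      case 3
      obtain j r where r: "1 \<le> r" "k \<le> r ^ 2" and j: "2 / \<alpha> \<le> 2 ^ j"
        and jr: "real (j * r) \<le> 9 * sqrt (real k) * ln (1 / \<alpha>)"
        using degree_bound[OF 3(2) \<alpha>(1) 3(1)] by blast
      have "real d ^ (30 * (j * r)) = real d powr real (30 * (j * r))"
        using d by (intro powr_realpow[symmetric]) auto
      also have "\<dots> \<le> B" unfolding B_def using d jr by (intro powr_mono) auto
      finally have dB: "real d ^ (30 * (j * r)) \<le> B" .
      then have "real d ^ (30 * (j * r)) / \<epsilon> \<le> B / \<epsilon>" using \<epsilon> by (intro divide_right_mono) auto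
      then have "real d ^ (30 * (j * r)) / \<epsilon> \<le> real n" using False by simp
      from private_release_exists[OF 3(2) kd d n \<alpha> r j \<epsilon> this]
      obtain A E tA tE where *: "differentially_private \<epsilon> n d A" "sanitizer_in_time n d tA A"
        "evaluator_in_time d k tE E" "real (tA + tE) \<le> real n * real d ^ (30 * (j * r))"
        "\<forall>D\<in>databases n d. measure_pmf.prob (A D) {z. \<forall>q\<in>marginals d k. \<bar>E z q - query_value q D\<bar> \<le> \<alpha>} \<ge> 9 / 10"
        by blast
      have "real n * real d ^ (30 * (j * r)) \<le> real n * B" using dB by (intro mult_left_mono) auto
      then have "?goal A E tA tE" using * by auto
      then show ?thesis by blast
    qed
  qed
  then show "\<exists>(A :: database \<Rightarrow> int list pmf) (E :: int list \<Rightarrow> marginal_query \<Rightarrow> real) tA tE.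
      differentially_private \<epsilon> n d A \<and> sanitizer_in_time n d tA A \<and> evaluator_in_time d k tE E \<and>
      real (tA + tE) \<le> real n * real d powr (270 * sqrt (real k) * ln (1 / \<alpha>)) \<and>
      (\<forall>D\<in>databases n d. real (length D) \<ge> real d powr (270 * sqrt (real k) * ln (1 / \<alpha>)) / \<epsilon> \<longrightarrow>
         measure_pmf.prob (A D) {z. \<forall>q\<in>marginals d k. \<bar>E z q - query_value q D\<bar> \<le> \<alpha>} \<ge> 9 / 10)"
    unfolding B_def .
qed

end
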